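(* Let $\alpha\ge0$, $\beta>-1$ be real numbers and $m,m'\in\{0,1,2,\ldots\}$. Then for every $r\in\mathbb{R}$, $$\sum_{l=1}^{\infty}J_{l+m'}(r)J_{l+m}(r)(l+\beta)^\alpha=\frac{2}{\pi^2}\int_{0}^{\pi/2}\int_{0}^{\pi}e^{i2r\cos\varphi\cos\theta}\,E_{\alpha,\beta,m,m'}(r,\varphi,\theta)\,d\varphi\,d\theta$$ and $$\sum_{l=1}^{\infty}J_{l+m'}(r)J_{l+m}(r)(l+\beta)^\alpha=\frac1\pi\int_{0}^{\pi}H_{\alpha,\beta,m,m'}(r,\varphi)\,d\varphi .$$
   Context: $J_n$ denotes the Bessel function of the first kind of order $n$. $\Phi$ denotes the Lerch transcendent, $\Phi(z,s,a)=\sum_{n=0}^\infty \frac{z^n}{(a+n)^s}$ for $|z|<1$ (or $|z|\le 1$ if $s>1$), extended to other $z$ by analytic continuation in $z$ (in particular to points $z\ne1$ of the unit circle). For $a>0$, $\beta>-1$, $\mu\in\mathbb{Z}$ and $\varphi\in[0,\pi]\setminus\{\pi/2\}$, $$F_{a,\beta,\mu}(\varphi):=-\tfrac12 e^{-i\varphi(\mu+2)}\left(e^{2i\varphi(\mu+2)}\,\Phi\!\left(-e^{2i\varphi},a,\beta+1\right)+\Phi\!\left(-e^{-2i\varphi},a,\beta+1\right)\right).$$ For integers $m,m'$ put $\mu:=m+m'$, $\nu:=m-m'$. The functions $E$ and $H$ are defined as follows. For $\alpha<0$, $$E_{\alpha,\beta,m,m'}(r,\varphi,\theta):=i^{-\mu}F_{-\alpha,\beta,\mu}(\varphi)\cos(\nu\theta),\qquad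 H_{\alpha,\beta,m,m'}(r,\varphi):=(-1)^{m'}J_\nu(2r\cos\varphi)F_{-\alpha,\beta,\mu}(\varphi),$$ and for $\alpha\ge0$, recursively, $$E_{\alpha,\beta,m,m'}:=\frac r2\left(E_{\alpha-1,\beta,m-1,m'}+E_{\alpha-1,\beta,m+1,m'}\right)+(\beta-m)E_{\alpha-1,\beta,m,m'},$$ $$H_{\alpha,\beta,m,m'}:=\frac r2\left(H_{\alpha-1,\beta,m-1,m'}+H_{\alpha-1,\beta,m+1,m'}\right)+(\beta-m)H_{\alpha-1,\beta,m,m'},$$ where all functions are evaluated at the same $(r,\varphi,\theta)$, respectively $(r,\varphi)$. *)

theory Defs
  imports "HOL-Analysis.Analysis"
begin

text \<open>
  Bessel function of the first kind of integer order. Since \<open>rGamma\<close> vanishes at the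
  non-positive integers, the power series also covers negative orders: the terms of index
  \<open>k < - n\<close>, which include all those with a negative exponent, are zero.
\<close>

definition bessel_J :: "int \<Rightarrow> real \<Rightarrow> real" where
  "bessel_J n x =
     (\<Sum>k. (-1) ^ k / fact k * rGamma (of_int (n + int k + 1)) * (x / 2) powi (n + 2 * int k))"

definition lerch_series :: "complex \<Rightarrow> real \<Rightarrow> real \<Rightarrow> complex" where
  "lerch_series z s a = (\<Sum>n. z ^ n / of_real ((a + real n) powr s))"

text \<open>
  The analytic continuation in \<open>z\<close> of the Lerch series from the open unit disc to the plane cut
  along \<open>[1, \<infinity>)\<close>. By the identity theorem its values on that domain do not depend on the
  choice; on the cut they are unspecified.
\<close>

definition lerch_continuation :: "real \<Rightarrow> real \<Rightarrow> complex \<Rightarrow> complex" where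
  "lerch_continuation s a =
     (SOME f. f holomorphic_on (- complex_of_real ` {1..}) \<and>
              (\<forall>z. norm z < 1 \<longrightarrow> f z = lerch_series z s a))"

definition lerch_Phi :: "complex \<Rightarrow> real \<Rightarrow> real \<Rightarrow> complex" where
  "lerch_Phi z s a =
     (if norm z < 1 \<or> (norm z \<le> 1 \<and> s > 1) then lerch_series z s a
      else lerch_continuation s a z)"

text \<open>
  Meaningful for \<open>a > 0\<close>, \<open>\<beta> > -1\<close> and \<open>\<phi> \<in> [0, \<pi>] - {\<pi>/2}\<close>. The value at
  \<open>\<phi> = \<pi>/2\<close> (where \<open>- exp (2 \<i> \<phi>) = 1\<close>) does not affect any integral over \<open>\<phi>\<close>.
\<close>

definition lerch_F :: "real \<Rightarrow> real \<Rightarrow> int \<Rightarrow> real \<Rightarrow> complex" where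
  "lerch_F a \<beta> \<mu> \<phi> =
     - (1 / 2) * exp (- (\<i> * of_real \<phi> * of_int (\<mu> + 2))) *
       (exp (2 * \<i> * of_real \<phi> * of_int (\<mu> + 2)) * lerch_Phi (- exp (2 * \<i> * of_real \<phi>)) a (\<beta> + 1)
        + lerch_Phi (- exp (- (2 * \<i> * of_real \<phi>))) a (\<beta> + 1))"

text \<open>The index \<open>m\<close> is an integer because the recursions decrease it below zero.\<close>

function kernel_E :: "real \<Rightarrow> real \<Rightarrow> int \<Rightarrow> int \<Rightarrow> real \<Rightarrow> real \<Rightarrow> real \<Rightarrow> complex" where
  "kernel_E \<alpha> \<beta> m m' r \<phi> \<theta> =
     (if \<alpha> < 0 then
        \<i> powi (- (m + m')) * lerch_F (- \<alpha>) \<beta> (m + m') \<phi> * of_real (cos (of_int (m - m') * \<theta>))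
      else
        of_real (r / 2) * (kernel_E (\<alpha> - 1) \<beta> (m - 1) m' r \<phi> \<theta>
                           + kernel_E (\<alpha> - 1) \<beta> (m + 1) m' r \<phi> \<theta>)
        + of_real (\<beta> - of_int m) * kernel_E (\<alpha> - 1) \<beta> m m' r \<phi> \<theta>)"
  by pat_completeness auto
termination
  by (relation "Wellfounded.measure (\<lambda>(\<alpha>, _). nat (\<lfloor>\<alpha>\<rfloor> + 1))") (auto simp: not_less)

function kernel_H :: "real \<Rightarrow> real \<Rightarrow> int \<Rightarrow> int \<Rightarrow> real \<Rightarrow> real \<Rightarrow> complex" where
  "kernel_H \<alpha> \<beta> m m' r \<phi> =
     (if \<alpha> < 0 then
        (-1) powi m' * of_real (bessel_J (m - m') (2 * r * cos \<phi>)) * lerch_F (- \<alpha>) \<beta> (m + m') \<phi>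
      else
        of_real (r / 2) * (kernel_H (\<alpha> - 1) \<beta> (m - 1) m' r \<phi>
                           + kernel_H (\<alpha> - 1) \<beta> (m + 1) m' r \<phi>)
        + of_real (\<beta> - of_int m) * kernel_H (\<alpha> - 1) \<beta> m m' r \<phi>)"
  by pat_completeness auto
termination
  by (relation "Wellfounded.measure (\<lambda>(\<alpha>, _). nat (\<lfloor>\<alpha>\<rfloor> + 1))") (auto simp: not_less)

declare kernel_E.simps [simp del] kernel_H.simps [simp del]

end

theory Submission
  imports Defs
begin

text \<open>
  Writing \<open>J\<^sub>p J\<^sub>q\<close> as an integral of \<open>J\<^bsub>p+q\<^esub>(2 r cos \<theta>)\<close> against \<open>cos ((p - q) \<theta>)\<close> (Neumann) turns the
  sum over \<open>l\<close> into an integral of \<open>\<Sum>l. (-1)^l cos ((2 l + \<mu>) \<phi>) (l + \<beta>)^\<alpha>\<close>, which for \<open>\<alpha> < 0\<close> is the Lerch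
  kernel \<open>F\<close>. In the \<open>H\<close> formula Neumann's formula is applied to the orders \<open>l + m\<close> and \<open>- (l + m')\<close>; in
  the \<open>E\<close> formula to \<open>l + m\<close> and \<open>l + m'\<close>, and \<open>J\<^bsub>2l+\<mu>\<^esub>(2 r cos \<theta>)\<close> is expanded once more. The recursion
  \<open>2 n J\<^sub>n(r) = r (J\<^bsub>n-1\<^esub>(r) + J\<^bsub>n+1\<^esub>(r))\<close> lowers \<open>\<alpha>\<close> by one, exactly as in the definitions of \<open>E\<close> and \<open>H\<close>.

  The analytic input is the representation of \<open>\<Phi>(z,s,a)\<close> as \<open>1/\<Gamma>(s)\<close> times the integral of
  \<open>t^(s-1) e^(-a t) / (1 - z e^(-t))\<close> over \<open>t > 0\<close>. It is holomorphic on the cut plane, it is the sum of the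
  series at every \<open>z \<noteq> 1\<close> of the closed unit disc, and it bounds all partial sums there by a multiple of
  \<open>\<bar>1 - z\<bar>^(-p)\<close> with some \<open>p < 1\<close>. Since \<open>\<bar>1 + e^(2i\<phi>)\<bar> = 2 \<bar>cos \<phi>\<bar>\<close>, this bound is integrable in \<open>\<phi>\<close>, and
  sum and integral may be exchanged by dominated convergence.
\<close>

subsection \<open>Integrals of periodic functions\<close>

text \<open>For \<open>c \<ge> 0\<close>, splitting [0, c + 2 pi] at c and at 2 pi gives two
  expressions for one integral, whose pieces over [0, c] and [2 pi, c + 2 pi] agree by periodicity.
  A negative shift is undone by applying this case to the shifted function.\<close>

lemma integral_periodic_shift:
  fixes f :: "real \<Rightarrow> complex"
  assumes f: "continuous_on UNIV f" and per: "\<And>t. f (t + 2 * pi) = f t"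
  shows "integral {0..2 * pi} (\<lambda>t. f (t + c)) = integral {0..2 * pi} f"
proof -
  have nonneg: "integral {0..2 * pi} (\<lambda>t. g (t + c)) = integral {0..2 * pi} g"
    if "c \<ge> 0" and g: "continuous_on UNIV g" and gper: "\<And>t. g (t + 2 * pi) = g t"
    for g :: "real \<Rightarrow> complex" and c
  proof -
    have int: "g integrable_on {a..b}" for a b
      by (rule integrable_continuous_interval) (rule continuous_on_subset[OF g], simp)
    have "integral {0..c} g + integral {c..c + 2 * pi} g = integral {0..c + 2 * pi} g"
      by (rule Henstock_Kurzweil_Integration.integral_combine) (use \<open>c \<ge> 0\<close> int in auto)
    moreover have "integral {0..2 * pi} g + integral {2 * pi..c + 2 * pi} g = integral {0..c + 2 * pi} g"
      by (rule Henstock_Kurzweil_Integration.integral_combine) (use \<open>c \<ge> 0\<close> int in auto)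
    moreover have "integral {2 * pi..c + 2 * pi} g = integral {0..c} g"
      using integral_shift_Icc_real[of 0 c g "2 * pi"] gper by (simp add: o_def add_ac)
    moreover have "integral {c..c + 2 * pi} g = integral {0..2 * pi} (\<lambda>t. g (t + c))"
      using integral_shift_Icc_real[of 0 "2 * pi" g c] by (simp add: o_def add_ac)
    ultimately show ?thesis by (metis add.commute add_left_cancel)
  qed
  show ?thesis
  proof (cases "c \<ge> 0")
    case True
    then show ?thesis using nonneg[OF _ f per] by simp
  next
    case False
    have "continuous_on UNIV (\<lambda>t. f (t + c))"
      by (intro continuous_on_compose2[OF f] continuous_intros) auto
    moreover have "f (t + 2 * pi + c) = f (t + c)" for t
      using per[of "t + c"] by (simp add: add_ac)
    ultimately show ?thesis
      using nonneg[of "- c" "\<lambda>t. f (t + c)"] False by simp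
  qed
qed

lemma integral_periodic_reflect:
  fixes f :: "real \<Rightarrow> complex"
  assumes f: "continuous_on UNIV f" and per: "\<And>t. f (t + 2 * pi) = f t"
  shows "integral {0..2 * pi} (\<lambda>t. f (- t)) = integral {0..2 * pi} f"
proof -
  have "integral {- (2 * pi)..0} f = integral {0..2 * pi} (\<lambda>t. f (t + - (2 * pi)))"
    using integral_shift_Icc_real[of 0 "2 * pi" f "- (2 * pi)"] by (simp add: o_def add_ac)
  also have "\<dots> = integral {0..2 * pi} f"
    by (rule integral_periodic_shift) fact+
  finally show ?thesis
    using Henstock_Kurzweil_Integration.integral_reflect_real[of "2 * pi" 0 "\<lambda>t. f (- t)"]
    by simp
qed

text \<open>The argument 2 t runs through two periods, and the substitution contributes the factor
  1/2.\<close>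

lemma integral_periodic_double:
  fixes f :: "real \<Rightarrow> complex"
  assumes f: "continuous_on UNIV f" and per: "\<And>t. f (t + 2 * pi) = f t"
  shows "integral {0..2 * pi} (\<lambda>t. f (2 * t)) = integral {0..2 * pi} f"
proof -
  have int: "f integrable_on {a..b}" for a b
    by (rule integrable_continuous_interval) (rule continuous_on_subset[OF f], simp)
  have "(\<lambda>x. x / 2) ` {0..4 * pi} = {0..2 * pi}"
    by (simp add: image_divide_atLeastAtMost)
  then have "integral {0..2 * pi} (\<lambda>t. f (2 * t)) = integral {0..4 * pi} f / 2"
    using integral_stretch_real[of 2 0 "4 * pi" f] by (simp add: scaleR_conv_of_real)
  also have "integral {0..4 * pi} f = integral {0..2 * pi} f + integral {2 * pi..4 * pi} f"
    by (rule Henstock_Kurzweil_Integration.integral_combine[symmetric]) (use int in auto)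
  also have "integral {2 * pi..4 * pi} f = integral {0..2 * pi} f"
    using integral_shift_Icc_real[of 0 "2 * pi" f "2 * pi"] per by (simp add: o_def add_ac)
  finally show ?thesis by simp
qed

text \<open>The second half of the period is moved to [- pi, 0] and reflected. In this way
  exponentials integrated over a period become cosines integrated over
  \<open>{0..pi}\<close>.\<close>

lemma integral_periodic_half:
  fixes f :: "real \<Rightarrow> complex"
  assumes f: "continuous_on UNIV f" and per: "\<And>t. f (t + 2 * pi) = f t"
  shows "integral {0..2 * pi} f = integral {0..pi} (\<lambda>t. f t + f (- t))"
proof -
  have int: "f integrable_on {a..b}" for a b
    by (rule integrable_continuous_interval) (rule continuous_on_subset[OF f], simp)
  have "continuous_on UNIV (\<lambda>t. f (- t))"
    by (intro continuous_on_compose2[OF f] continuous_intros) auto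
  then have int': "(\<lambda>t. f (- t)) integrable_on {a..b}" for a b
    by (intro integrable_continuous_interval) (rule continuous_on_subset, auto)
  have "integral {0..2 * pi} f = integral {0..pi} f + integral {pi..2 * pi} f"
    by (rule Henstock_Kurzweil_Integration.integral_combine[symmetric]) (use int in auto)
  also have "integral {pi..2 * pi} f = integral {- pi..0} f"
    using integral_shift_Icc_real[of "- pi" 0 f "2 * pi"] per by (simp add: o_def add_ac)
  also have "\<dots> = integral {0..pi} (\<lambda>t. f (- t))"
    using Henstock_Kurzweil_Integration.integral_reflect_real[of pi 0 "\<lambda>t. f (- t)"] by simp
  finally show ?thesis
    by (simp add: Henstock_Kurzweil_Integration.integral_add int int')
qed

text \<open>The M-test makes the convergence uniform, and uniform limits pass through the integral.
  It serves the exponential series behind the Bessel functions.\<close>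

lemma integral_sums_dominated:
  fixes f :: "nat \<Rightarrow> real \<Rightarrow> complex"
  assumes f: "\<And>k. continuous_on {a..b} (f k)"
    and bound: "\<And>k t. t \<in> {a..b} \<Longrightarrow> norm (f k t) \<le> B k" and B: "summable B"
    and sums: "\<And>t. t \<in> {a..b} \<Longrightarrow> (\<lambda>k. f k t) sums g t"
  shows "(\<lambda>k. integral {a..b} (f k)) sums integral {a..b} g"
proof -
  have "uniform_limit {a..b} (\<lambda>n t. \<Sum>k<n. f k t) (\<lambda>t. \<Sum>k. f k t) sequentially"
    by (rule Weierstrass_m_test[OF bound B])
  then have lim: "uniform_limit {a..b} (\<lambda>n t. \<Sum>k<n. f k t) g sequentially"
    by (rule uniform_limit_cong'[THEN iffD1, rotated -1]) (use sums in \<open>auto simp: sums_iff\<close>)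
  obtain I J where I: "\<And>n. ((\<lambda>t. \<Sum>k<n. f k t) has_integral I n) {a..b}"
    and J: "(g has_integral J) {a..b}" and "I \<longlonglongrightarrow> J"
    by (rule uniform_limit_integral[OF lim]) (auto intro!: continuous_intros f)
  moreover have "I = (\<lambda>n. \<Sum>k<n. integral {a..b} (f k))"
  proof
    fix n
    show "I n = (\<Sum>k<n. integral {a..b} (f k))" using integral_unique[OF I[of n]]
    by (subst (asm) Henstock_Kurzweil_Integration.integral_sum)
       (auto intro!: integrable_continuous_interval f)
  qed
  moreover have "J = integral {a..b} g"
    using integral_unique[OF J] by simp
  ultimately show ?thesis by (simp add: sums_def)
qed

section \<open>Orthogonality of the exponentials over a period\<close>

lemma cis_int_periodic [simp]: "cis (of_int n * (t + 2 * pi)) = cis (of_int n * t)"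
  by (simp add: ring_distribs flip: cis_mult) (metis cis_multiple_2pi Ints_of_int mult.commute mult.assoc mult_1_right)

lemma integral_cis_int:
  "integral {0..2 * pi} (\<lambda>t. cis (of_int n * t)) = (if n = 0 then 2 * of_real pi else 0)"
proof (cases "n = 0")
  case False
  have "((\<lambda>t. cis (of_int n * t) / (\<i> * of_int n)) has_vector_derivative cis (of_int n * t)) (at t within A)" for t A
    using False unfolding cis_conv_exp
    by (auto intro!: derivative_eq_intros has_vector_derivative_real_field simp: field_simps)
  then have "((\<lambda>t. cis (of_int n * t)) has_integral
      cis (of_int n * (2 * pi)) / (\<i> * of_int n) - cis (of_int n * 0) / (\<i> * of_int n)) {0..2 * pi}"
    by (intro fundamental_theorem_of_calculus) auto
  moreover have "cis (of_int n * (2 * pi)) = 1"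
    using cis_int_periodic[of n 0] by (simp del: cis_int_periodic)
  ultimately show ?thesis using False by (simp add: has_integral_iff)
qed (simp add: scaleR_conv_of_real)

subsection \<open>Bessel functions of integer order\<close>

lemma rGamma_of_int:
  "rGamma (real_of_int n + 1) = (if n < 0 then 0 else 1 / fact (nat n))"
proof (cases "n < 0")
  case True
  then have "real_of_int (n + 1) \<in> \<int>\<^sub>\<le>\<^sub>0"
    by (subst of_int_in_nonpos_Ints_iff) auto
  with True show ?thesis by (simp add: rGamma_eq_zero_iff)
next
  case False
  then have "real_of_int n + 1 = 1 + of_nat (nat n)" by simp
  then show ?thesis using False Gamma_fact[of "nat n", where ?'a = real]
    by (simp add: rGamma_inverse_Gamma field_simps del: of_nat_nat)
qed

text \<open>A Fourier coefficient of exp (c e^(it)): after expanding the exponential, orthogonality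
  keeps only the term of index k = - n.\<close>

lemma integral_exp_cis_int:
  fixes c :: real
  shows "integral {0..2 * pi} (\<lambda>t. exp (of_real c * cis t) * cis (of_int n * t)) =
    2 * of_real pi * of_real (rGamma (of_int (- n) + 1) * c powi (- n))"
proof -
  have sums: "(\<lambda>k. integral {0..2 * pi} (\<lambda>t. of_real (c ^ k / fact k) * cis (of_int (int k + n) * t))) sums
        integral {0..2 * pi} (\<lambda>t. exp (of_real c * cis t) * cis (of_int n * t))"
  proof (rule integral_sums_dominated)
    show "(\<lambda>k. of_real (c ^ k / fact k) * cis (of_int (int k + n) * t)) sums
          (exp (of_real c * cis t) * cis (of_int n * t))" for t
    proof -
      have "(\<lambda>k. (of_real c * cis t) ^ k /\<^sub>R fact k * cis (of_int n * t)) sums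
            (exp (of_real c * cis t) * cis (of_int n * t))"
        by (intro sums_mult2 exp_converges)
      moreover have "(of_real c * cis t) ^ k /\<^sub>R fact k * cis (of_int n * t) =
          of_real (c ^ k / fact k) * cis (of_int (int k + n) * t)" for k
        by (simp add: power_mult_distrib Complex.DeMoivre scaleR_conv_of_real distrib_right mult.commute[of t] divide_inverse
            flip: cis_mult)
      ultimately show ?thesis by simp
    qed
    show "summable (\<lambda>k. \<bar>c\<bar> ^ k / fact k)"
      using summable_exp[of "\<bar>c\<bar>"] by (simp add: field_simps)
    show "norm (of_real (c ^ k / fact k) * cis (of_int (int k + n) * t)) \<le> \<bar>c\<bar> ^ k / fact k" for k t
      by (simp add: norm_mult norm_divide norm_power power_abs)
  qed (intro continuous_intros)
  \<comment> \<open>For \<open>n > 0\<close> no index satisfies k = - n. The truncation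
    \<open>nat (- n) = 0\<close> then selects index 0, where the stated value is 0 because
    \<open>rGamma\<close> vanishes.\<close>
  have eq: "integral {0..2 * pi} (\<lambda>t. of_real (c ^ k / fact k) * cis (of_int (int k + n) * t)) =
      (if k = nat (- n) then 2 * of_real pi * of_real (rGamma (of_int (- n) + 1) * c powi (- n)) else 0)" for k
  proof -
    have "integral {0..2 * pi} (\<lambda>t. of_real (c ^ k / fact k) * cis (of_int (int k + n) * t)) =
        of_real (c ^ k / fact k) * (if int k + n = 0 then 2 * of_real pi else 0)"
      unfolding integral_mult_right integral_cis_int ..
    also have "\<dots> = (if k = nat (- n)
        then 2 * of_real pi * of_real (rGamma (of_int (- n) + 1) * c powi (- n)) else 0)"
    proof (cases "n \<le> 0")
      case True
      then obtain j where "n = - int j" using nonpos_int_cases by blast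
      then show ?thesis by (simp add: rGamma_of_int[of "int j", simplified])
    next
      case False
      then show ?thesis by (simp add: rGamma_of_int[of "- n", simplified])
    qed
    finally show ?thesis .
  qed
  show ?thesis
    by (rule sums_unique2[OF sums[unfolded eq] sums_single])
qed

text \<open>Bessel's integral, from the generating function: cis (x sin t) is the product of exp
  ((x/2) e^(it)) and exp (- (x/2) e^(-it)). Only the second factor is expanded; the Fourier
  coefficients of the first come from \<open>integral_exp_cis_int\<close>, so that a single series
  arises, the defining one.\<close>

lemma bessel_J_integral:
  "complex_of_real (bessel_J n x) =
     integral {0..2 * pi} (\<lambda>t. cis (x * sin t - of_int n * t)) / (2 * of_real pi)"
proof -
  define a where "a k = (-1) ^ k / fact k * rGamma (of_int (n + int k + 1)) * (x / 2) powi (n + 2 * int k)" for k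
  have "(\<lambda>k. integral {0..2 * pi} (\<lambda>t. of_real ((- x / 2) ^ k / fact k) *
            (exp (of_real (x / 2) * cis t) * cis (of_int (- n - int k) * t)))) sums
        integral {0..2 * pi} (\<lambda>t. cis (x * sin t - of_int n * t))"
  proof (rule integral_sums_dominated)
    show "(\<lambda>k. of_real ((- x / 2) ^ k / fact k) *
            (exp (of_real (x / 2) * cis t) * cis (of_int (- n - int k) * t))) sums
          cis (x * sin t - of_int n * t)" for t
    proof -
      let ?E = "exp (of_real (x / 2) * cis t) * cis (- (of_int n * t))"
      have "(\<lambda>k. (of_real (- x / 2) * cis (- t)) ^ k /\<^sub>R fact k * ?E) sums
            (exp (of_real (- x / 2) * cis (- t)) * ?E)"
        by (intro sums_mult2 exp_converges)
      also have "exp (of_real (- x / 2) * cis (- t)) * ?E =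
          exp (of_real (- x / 2) * cis (- t) + of_real (x / 2) * cis t) * cis (- (of_int n * t))"
        by (simp only: exp_add mult.assoc)
      also have "of_real (- x / 2) * cis (- t) + of_real (x / 2) * cis t = \<i> * of_real (x * sin t)"
        by (simp add: complex_eq_iff)
      also have "exp (\<i> * of_real (x * sin t)) = cis (x * sin t)"
        by (simp add: cis_conv_exp)
      finally have "(\<lambda>k. (of_real (- x / 2) * cis (- t)) ^ k /\<^sub>R fact k * ?E) sums
          cis (x * sin t - of_int n * t)"
        by (simp add: cis_mult)
      moreover have "(of_real (- x / 2) * cis (- t)) ^ k /\<^sub>R fact k * ?E =
          of_real ((- x / 2) ^ k / fact k) *
            (exp (of_real (x / 2) * cis t) * cis (of_int (- n - int k) * t))" for k
      proof -
        have *: "cis (of_int (- n - int k) * t) = cis (- t) ^ k * cis (- (of_int n * t))"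
          unfolding Complex.DeMoivre cis_mult by (rule arg_cong[of _ _ cis]) (simp add: algebra_simps)
        show ?thesis
          unfolding * power_mult_distrib scaleR_conv_of_real divide_inverse of_real_mult of_real_power
          by (simp only: mult_ac)
      qed
      ultimately show ?thesis by simp
    qed
    show "summable (\<lambda>k. \<bar>x / 2\<bar> ^ k / fact k * exp \<bar>x / 2\<bar>)"
      using summable_mult2[OF summable_exp[of "\<bar>x / 2\<bar>"], of "exp \<bar>x / 2\<bar>"]
      by (simp only: divide_inverse mult_ac)
    show "norm (of_real ((- x / 2) ^ k / fact k) *
            (exp (of_real (x / 2) * cis t) * cis (of_int (- n - int k) * t)))
          \<le> \<bar>x / 2\<bar> ^ k / fact k * exp \<bar>x / 2\<bar>" for k t
    proof -
      have "norm (exp (of_real (x / 2) * cis t)) \<le> exp (norm (of_real (x / 2) * cis t))"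
        by (rule norm_exp)
      then have "norm (exp (of_real (x / 2) * cis t)) \<le> exp \<bar>x / 2\<bar>"
        by (simp add: norm_mult)
      then show ?thesis
        by (simp add: norm_mult norm_divide norm_power power_abs mult_left_mono divide_right_mono)
    qed
  qed (intro continuous_intros)
  moreover have "integral {0..2 * pi} (\<lambda>t. of_real ((- x / 2) ^ k / fact k) *
            (exp (of_real (x / 2) * cis t) * cis (of_int (- n - int k) * t))) =
        2 * of_real pi * of_real (a k)" for k
  proof -
    \<comment> \<open>If \<open>n + int k\<close> is negative, both sides vanish with
      \<open>rGamma\<close>. Otherwise all exponents are natural numbers and may be added even at
      \<open>x = 0\<close>.\<close>
    have "(- x / 2) ^ k / fact k * (rGamma (of_int (n + int k) + 1) * (x / 2) powi (n + int k)) = a k"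
    proof (cases "n + int k < 0")
      case True
      then show ?thesis using rGamma_of_int[of "n + int k"] by (simp add: a_def add_ac)
    next
      case False
      then obtain j where j: "n + int k = int j" by (metis nonneg_int_cases not_less)
      then have jk: "n + 2 * int k = int (j + k)" by simp
      have "(- x / 2) ^ k = (- 1) ^ k * (x / 2) ^ k"
        using power_mult_distrib[of "-1" "x / 2" k] by simp
      then show ?thesis unfolding a_def j jk power_int_of_nat power_add by simp
    qed
    then have "of_real ((- x / 2) ^ k / fact k * (rGamma (of_int (n + int k) + 1) * (x / 2) powi (n + int k)))
        = complex_of_real (a k)"
      by simp
    moreover have "- (- n - int k) = n + int k" by simp
    ultimately show ?thesis
      unfolding integral_mult_right integral_exp_cis_int by (metis mult.assoc mult.commute of_real_mult)
  qed
  ultimately have "(\<lambda>k. 2 * complex_of_real pi * of_real (a k)) sums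
        integral {0..2 * pi} (\<lambda>t. cis (x * sin t - of_int n * t))"
    by simp
  then have "(\<lambda>k. complex_of_real (a k)) sums
        (integral {0..2 * pi} (\<lambda>t. cis (x * sin t - of_int n * t)) / (2 * of_real pi))"
    using sums_divide[where c = "2 * complex_of_real pi"] by fastforce
  \<comment> \<open>Summability, read off from the complex series, is what makes the
    \<open>suminf\<close> in \<open>bessel_J\<close> the actual sum.\<close>
  moreover from this have "summable a"
    using summable_of_real_iff sums_summable by blast
  then have "(\<lambda>k. complex_of_real (a k)) sums of_real (suminf a)"
    by (intro sums_of_real summable_sums)
  ultimately show ?thesis
    unfolding bessel_J_def a_def by (rule sums_unique2[symmetric])
qed

lemma periodic_bessel_integrand [simp]:
  "cis (x * sin (t + 2 * pi) - of_int n * (t + 2 * pi)) = cis (x * sin t - of_int n * t)"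
proof -
  have "cis (x * sin (t + 2 * pi) - of_int n * (t + 2 * pi)) =
      cis (x * sin t) * cis (of_int (- n) * (t + 2 * pi))"
    by (simp add: cis_mult)
  also have "\<dots> = cis (x * sin t) * cis (of_int (- n) * t)"
    by (simp only: cis_int_periodic)
  finally show ?thesis by (simp add: cis_mult)
qed

text \<open>Substituting pi - t in Bessel's integral preserves sin t and turns - n t into n t - n
  pi; the constant factor cis (- n pi) is the sign.\<close>

lemma bessel_J_minus: "bessel_J (- n) x = (-1) powi n * bessel_J n x"
proof -
  define f where "f t = cis (x * sin t - of_int n * t)" for t
  have f: "continuous_on UNIV f" and per: "f (t + 2 * pi) = f t" for t
    unfolding f_def by (auto intro!: continuous_intros simp del: sin_periodic)
  have "integral {0..2 * pi} f = integral {0..2 * pi} (\<lambda>t. f (- t))"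
    by (rule integral_periodic_reflect[symmetric]) fact+
  also have "\<dots> = integral {0..2 * pi} (\<lambda>t. f (- (t + - pi)))"
  proof (rule integral_periodic_shift[symmetric])
    show "continuous_on UNIV (\<lambda>t. f (- t))"
      by (intro continuous_on_compose2[OF f] continuous_intros) auto
    show "f (- (t + 2 * pi)) = f (- t)" for t
      using per[of "- t - 2 * pi"] by simp
  qed
  also have "\<dots> = integral {0..2 * pi} (\<lambda>t. (-1) powi n * cis (x * sin t - of_int (- n) * t))"
  proof (rule integral_cong)
    fix t
    have "f (- (t + - pi)) = cis (x * sin t - of_int (- n) * t) * cis (of_int (- n) * pi)"
      unfolding f_def by (simp add: cis_mult algebra_simps)
    also have "cis (of_int (- n) * pi) = (-1) powi n"
      using cis_power_int[of "- pi" n] by (simp add: cis_conv_exp exp_minus)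
    finally show "f (- (t + - pi)) = (-1) powi n * cis (x * sin t - of_int (- n) * t)"
      by simp
  qed
  finally have "integral {0..2 * pi} f =
      (-1) powi n * integral {0..2 * pi} (\<lambda>t. cis (x * sin t - of_int (- n) * t))"
    by simp
  then have "complex_of_real (bessel_J n x) = (-1) powi n * of_real (bessel_J (- n) x)"
    unfolding bessel_J_integral f_def by simp
  then have "complex_of_real (bessel_J n x) = of_real ((-1) powi n * bessel_J (- n) x)" by simp
  then have "bessel_J n x = (-1) powi n * bessel_J (- n) x" by (simp only: of_real_eq_iff)
  then show ?thesis by (auto simp: power_int_minus_left split: if_splits)
qed

lemma bessel_J_minus_arg: "bessel_J n (- x) = bessel_J (- n) x"
proof -
  have "complex_of_real (bessel_J n (- x)) = of_real (bessel_J (- n) x)"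
    unfolding bessel_J_integral
    using integral_periodic_reflect[of "\<lambda>t. cis (- x * sin t - of_int n * t)",
        OF _ periodic_bessel_integrand]
    by (simp add: continuous_intros)
  then show ?thesis by simp
qed

text \<open>The derivative of the Bessel integrand integrates to 0 over a period. Its factor x cos t
  - n yields the neighbouring orders through 2 cos t = e^(it) + e^(-it).\<close>

lemma bessel_J_recurrence:
  "of_int n * bessel_J n x = x / 2 * (bessel_J (n - 1) x + bessel_J (n + 1) x)"
proof -
  define f where "f m t = cis (x * sin t - of_int m * t)" for m :: int and t
  have int: "f m integrable_on {0..2 * pi}" for m
    unfolding f_def by (intro integrable_continuous_interval continuous_intros)
  have "(f n has_vector_derivative
      \<i> * (of_real (x / 2) * (f (n - 1) t + f (n + 1) t) - of_int n * f n t)) (at t within A)" for t A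
  proof -
    have "((\<lambda>t. x * sin t - of_int n * t) has_vector_derivative x * cos t - of_int n) (at t within A)"
      unfolding has_real_derivative_iff_has_vector_derivative[symmetric]
      by (auto intro!: derivative_eq_intros)
    moreover have "(cis has_vector_derivative \<i> * cis u) (at u within B)" for u B
      unfolding cis_conv_exp by (auto intro!: derivative_eq_intros has_vector_derivative_real_field)
    ultimately have "(f n has_vector_derivative (x * cos t - of_int n) *\<^sub>R (\<i> * f n t)) (at t within A)"
      unfolding f_def by (rule vector_diff_chain_within[unfolded o_def])
    then have "(f n has_vector_derivative f n t * (\<i> * of_real (x * cos t - of_int n))) (at t within A)"
      by (simp add: scaleR_conv_of_real mult_ac)
    moreover have "f (n - 1) t + f (n + 1) t = of_real (2 * cos t) * f n t"
    proof -
      have "f (n - 1) t = f n t * cis t" "f (n + 1) t = f n t * cis (- t)"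
        by (simp_all add: f_def cis_mult algebra_simps)
      moreover have "cis t + cis (- t) = of_real (2 * cos t)" by (simp add: complex_eq_iff)
      ultimately show ?thesis by (metis distrib_left mult.commute)
    qed
    ultimately show ?thesis by (simp add: algebra_simps)
  qed
  then have "((\<lambda>t. \<i> * (of_real (x / 2) * (f (n - 1) t + f (n + 1) t) - of_int n * f n t))
      has_integral f n (2 * pi) - f n 0) {0..2 * pi}"
    by (intro fundamental_theorem_of_calculus) auto
  moreover have "f n (2 * pi) = f n 0"
    using periodic_bessel_integrand[of x 0 n] by (simp add: f_def del: periodic_bessel_integrand)
  ultimately have "((\<lambda>t. \<i> * (of_real (x / 2) * (f (n - 1) t + f (n + 1) t) - of_int n * f n t))
      has_integral 0) {0..2 * pi}"
    by (simp only: diff_self)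
  then have "0 = integral {0..2 * pi}
      (\<lambda>t. \<i> * (of_real (x / 2) * (f (n - 1) t + f (n + 1) t) - of_int n * f n t))"
    by (rule integral_unique[symmetric])
  also have "\<dots> = \<i> * (of_real (x / 2) *
      (integral {0..2 * pi} (f (n - 1)) + integral {0..2 * pi} (f (n + 1))) - of_int n * integral {0..2 * pi} (f n))"
    by (simp add: Henstock_Kurzweil_Integration.integral_add Henstock_Kurzweil_Integration.integral_diff
        int integrable_add integrable_on_mult_right)
  finally have "of_int n * integral {0..2 * pi} (f n) =
      of_real (x / 2) * (integral {0..2 * pi} (f (n - 1)) + integral {0..2 * pi} (f (n + 1)))"
    by simp
  moreover have "integral {0..2 * pi} (f m) = 2 * of_real pi * of_real (bessel_J m x)" for m
    unfolding bessel_J_integral f_def by simp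
  ultimately have "complex_of_real (of_int n * bessel_J n x) = of_real (x / 2 * (bessel_J (n - 1) x + bessel_J (n + 1) x))"
    by (simp add: distrib_left[symmetric] mult.left_commute[of _ 2] mult.left_commute[of _ "complex_of_real pi"]
        mult.commute[of _ 2])
  then show ?thesis by (simp only: of_real_eq_iff)
qed

lemma continuous_on_bessel_J [continuous_intros]:
  assumes "continuous_on A f"
  shows "continuous_on A (\<lambda>x. bessel_J n (f x))"
proof -
  have "continuous_on UNIV (\<lambda>x. integral (cbox 0 (2 * pi)) (\<lambda>t. cis (x * sin t - of_int n * t)))"
    by (rule integral_continuous_on_param) (auto intro!: continuous_intros simp: case_prod_unfold)
  then have "continuous_on UNIV (\<lambda>x. complex_of_real (bessel_J n x))"
    unfolding bessel_J_integral by (intro continuous_intros) auto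
  then have "continuous_on UNIV (\<lambda>x. Re (complex_of_real (bessel_J n x)))"
    by (rule continuous_on_Re)
  then have "continuous_on UNIV (bessel_J n)" by simp
  from continuous_on_compose2[OF this assms] show ?thesis by simp
qed

lemma abs_bessel_J_le_1: "\<bar>bessel_J n x\<bar> \<le> 1"
proof -
  have "norm (integral {0..2 * pi} (\<lambda>t. cis (x * sin t - of_int n * t))) \<le> 1 * (2 * pi - 0)"
    by (rule integral_bound) (auto intro!: continuous_intros)
  then have "norm (complex_of_real (bessel_J n x)) \<le> 1"
    unfolding bessel_J_integral by (simp add: norm_divide norm_mult)
  then show ?thesis by simp
qed

subsection \<open>Neumann product formulas\<close>

text \<open>In Bessel's integral a shift by pi / 2 turns the sine into a cosine at the cost of the
  factor i^n. The phase is then even in t, so folding the period leaves the cosine of n t.\<close>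

lemma bessel_J_integral_cos:
  "integral {0..pi} (\<lambda>t. cis (x * cos t) * of_real (cos (of_int n * t))) =
     of_real pi * \<i> powi n * of_real (bessel_J n x)"
proof -
  define f where "f t = cis (x * sin t - of_int n * t)" for t
  define g where "g t = cis (x * cos t - of_int n * t)" for t
  have g: "g t = \<i> powi n * f (t + pi / 2)" for t
  proof -
    have "\<i> powi n = cis (of_int n * (pi / 2))"
      unfolding cis_power_int[symmetric] by simp
    then show ?thesis
      by (simp add: f_def g_def cis_mult sin_add algebra_simps)
  qed
  have "integral {0..2 * pi} g = \<i> powi n * integral {0..2 * pi} (\<lambda>t. f (t + pi / 2))"
    unfolding g by (rule integral_mult_right)
  also have "integral {0..2 * pi} (\<lambda>t. f (t + pi / 2)) = integral {0..2 * pi} f"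
    unfolding f_def
    by (rule integral_periodic_shift) (auto intro!: continuous_intros simp del: sin_periodic)
  also have "\<dots> = 2 * of_real pi * of_real (bessel_J n x)"
    unfolding bessel_J_integral f_def by simp
  finally have "integral {0..2 * pi} g = 2 * of_real pi * \<i> powi n * of_real (bessel_J n x)"
    by simp
  moreover have "g (t + 2 * pi) = g t" for t
  proof -
    have "f (t + pi / 2 + 2 * pi) = f (t + pi / 2)"
      unfolding f_def by (rule periodic_bessel_integrand)
    then show ?thesis unfolding g by (simp add: add_ac)
  qed
  then have "integral {0..2 * pi} g = integral {0..pi} (\<lambda>t. g t + g (- t))"
    unfolding g_def by (intro integral_periodic_half) (auto intro!: continuous_intros)
  moreover have "g t + g (- t) = 2 * (cis (x * cos t) * of_real (cos (of_int n * t)))" for t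
  proof -
    have "g t + g (- t) = cis (x * cos t) * (cis (- (of_int n * t)) + cis (of_int n * t))"
      by (simp add: g_def distrib_left cis_mult)
    also have "cis (- (of_int n * t)) + cis (of_int n * t) = of_real (2 * cos (of_int n * t))"
      by (simp add: complex_eq_iff)
    finally show ?thesis by simp
  qed
  ultimately show ?thesis by simp
qed

text \<open>Neumann's formula. Writing \<open>bessel_J (p + q)\<close> as Bessel's integral and
  using 2 cos \<theta> sin t = sin (t - \<theta>) + sin (t + \<theta>), the integrand factors into
  the integrands of orders p at t - \<theta> and q at t + \<theta>. Shifting t by \<theta> leaves
  \<theta> in the second factor only, as t + 2 \<theta>; after exchanging the integrals, the
  \<theta>-integral no longer depends on t.\<close>

lemma bessel_J_product_cis:
  "complex_of_real (bessel_J p r * bessel_J q r) =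
     integral {0..2 * pi}
       (\<lambda>\<theta>. of_real (bessel_J (p + q) (2 * r * cos \<theta>)) * cis (of_int (p - q) * \<theta>)) / (2 * of_real pi)"
proof -
  define f where "f n t = cis (r * sin t - of_int n * t)" for n :: int and t
  have f: "continuous_on UNIV (f n)" for n
    unfolding f_def by (intro continuous_intros)
  have per: "f n (t + 2 * pi) = f n t" for n t
    unfolding f_def by (rule periodic_bessel_integrand)
  have J: "2 * of_real pi * of_real (bessel_J n r) = integral {0..2 * pi} (f n)" for n
    unfolding bessel_J_integral f_def by simp
  have "2 * of_real pi * (of_real (bessel_J (p + q) (2 * r * cos \<theta>)) * cis (of_int (p - q) * \<theta>)) =
      integral {0..2 * pi} (\<lambda>t. f p t * f q (t + 2 * \<theta>))" for \<theta>
  proof -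
    have sum: "2 * r * cos \<theta> * sin t = r * sin (t - \<theta>) + r * sin (t + \<theta>)" for t
      by (simp add: sin_add sin_diff algebra_simps)
    have "2 * of_real pi * (of_real (bessel_J (p + q) (2 * r * cos \<theta>)) * cis (of_int (p - q) * \<theta>)) =
        integral {0..2 * pi} (\<lambda>t. cis (2 * r * cos \<theta> * sin t - of_int (p + q) * t)) * cis (of_int (p - q) * \<theta>)"
      by (simp add: bessel_J_integral)
    also have "\<dots> = integral {0..2 * pi}
        (\<lambda>t. cis (2 * r * cos \<theta> * sin t - of_int (p + q) * t) * cis (of_int (p - q) * \<theta>))"
      by (rule integral_mult_left[symmetric])
    also have "\<dots> = integral {0..2 * pi} (\<lambda>t. f p (t - \<theta>) * f q (t + \<theta>))"
      unfolding f_def cis_mult sum by (simp add: algebra_simps)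
    also have "\<dots> = integral {0..2 * pi} (\<lambda>t. f p (t + \<theta> - \<theta>) * f q (t + \<theta> + \<theta>))"
    proof (rule integral_periodic_shift[symmetric])
      show "continuous_on UNIV (\<lambda>t. f p (t - \<theta>) * f q (t + \<theta>))"
        unfolding f_def by (intro continuous_intros)
      show "f p (t + 2 * pi - \<theta>) * f q (t + 2 * pi + \<theta>) = f p (t - \<theta>) * f q (t + \<theta>)" for t
        using per[of p "t - \<theta>"] per[of q "t + \<theta>"] by (simp add: algebra_simps)
    qed
    finally show ?thesis by (simp add: add_ac)
  qed
  then have "2 * of_real pi * integral {0..2 * pi}
        (\<lambda>\<theta>. of_real (bessel_J (p + q) (2 * r * cos \<theta>)) * cis (of_int (p - q) * \<theta>)) =
      integral {0..2 * pi} (\<lambda>\<theta>. integral {0..2 * pi} (\<lambda>t. f p t * f q (t + 2 * \<theta>)))"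
    unfolding integral_mult_right[symmetric] by simp
  also have "\<dots> = integral {0..2 * pi} (\<lambda>t. integral {0..2 * pi} (\<lambda>\<theta>. f p t * f q (t + 2 * \<theta>)))"
    unfolding cbox_interval[symmetric] f_def
    by (rule integral_swap_continuous) (auto intro!: continuous_intros simp: case_prod_unfold)
  also have "\<dots> = integral {0..2 * pi} (\<lambda>t. f p t * integral {0..2 * pi} (f q))"
  proof -
    have "integral {0..2 * pi} (\<lambda>\<theta>. f p t * f q (t + 2 * \<theta>)) = f p t * integral {0..2 * pi} (f q)" for t
    proof -
      have "integral {0..2 * pi} (\<lambda>\<theta>. f q (t + 2 * \<theta>)) = integral {0..2 * pi} (\<lambda>u. f q (t + u))"
      proof (rule integral_periodic_double)
        show "continuous_on UNIV (\<lambda>u. f q (t + u))"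
          unfolding f_def by (intro continuous_intros)
        show "f q (t + (u + 2 * pi)) = f q (t + u)" for u
          using per[of q "t + u"] by (simp add: add_ac)
      qed
      also have "\<dots> = integral {0..2 * pi} (f q)"
        using integral_periodic_shift[OF f per, of q t] by (simp add: add_ac)
      finally show ?thesis by simp
    qed
    then show ?thesis by (simp only:)
  qed
  also have "\<dots> = (2 * of_real pi * of_real (bessel_J p r)) * (2 * of_real pi * of_real (bessel_J q r))"
    unfolding J by (rule integral_mult_left)
  finally show ?thesis by (simp add: field_simps)
qed

lemma bessel_J_product:
  "((\<lambda>\<theta>. bessel_J (p + q) (2 * r * cos \<theta>) * cos (of_int (p - q) * \<theta>))
     has_integral pi * bessel_J p r * bessel_J q r) {0..pi}"
proof -
  define g where "g \<theta> = of_real (bessel_J (p + q) (2 * r * cos \<theta>)) * cis (of_int (p - q) * \<theta>)" for \<theta>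
  define h where "h \<theta> = bessel_J (p + q) (2 * r * cos \<theta>) * cos (of_int (p - q) * \<theta>)" for \<theta>
  have "h integrable_on {0..pi}"
    unfolding h_def by (intro integrable_continuous_interval continuous_intros)
  then have h: "(h has_integral integral {0..pi} h) {0..pi}"
    by (rule integrable_integral)
  have "2 * of_real pi * complex_of_real (bessel_J p r * bessel_J q r) = integral {0..2 * pi} g"
    unfolding bessel_J_product_cis g_def by simp
  also have "\<dots> = integral {0..pi} (\<lambda>t. g t + g (- t))"
    unfolding g_def by (intro integral_periodic_half continuous_intros) (simp only: cos_periodic cis_int_periodic)
  also have "\<dots> = integral {0..pi} (\<lambda>t. of_real (2 * h t))"
    by (rule arg_cong[of _ _ "integral _"]) (auto simp: g_def h_def complex_eq_iff)
  also have "\<dots> = of_real (2 * integral {0..pi} h)"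
    by (intro integral_unique has_integral_of_real has_integral_mult_right h)
  finally have "of_real (2 * integral {0..pi} h) = complex_of_real (2 * pi * (bessel_J p r * bessel_J q r))"
    by simp
  then have "integral {0..pi} h = pi * bessel_J p r * bessel_J q r"
    unfolding of_real_eq_iff by simp
  with h show ?thesis unfolding h_def by simp
qed

text \<open>Under reflection of \<theta> at pi / 2 both factors acquire the same sign, because p + q
  and p - q have equal parity. The integrand is thus symmetric and half of
  \<open>bessel_J_product\<close> remains.\<close>

lemma bessel_J_product_quarter:
  "((\<lambda>\<theta>. bessel_J (p + q) (2 * r * cos \<theta>) * cos (of_int (p - q) * \<theta>))
     has_integral pi / 2 * bessel_J p r * bessel_J q r) {0..pi / 2}"
proof -
  define h where "h \<theta> = bessel_J (p + q) (2 * r * cos \<theta>) * cos (of_int (p - q) * \<theta>)" for \<theta>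
  have int: "h integrable_on {a..b}" for a b
    unfolding h_def by (intro integrable_continuous_interval continuous_intros)
  have mirror: "h (- t + pi) = h t" for t
  proof -
    have "cos (of_int (p - q) * (- t + pi)) = (-1) powi (p + q) * cos (of_int (p - q) * t)"
    proof -
      have "cos (of_int (p - q) * (- t + pi)) =
          cos (of_int (p - q) * pi) * cos (of_int (p - q) * t) + sin (of_int (p - q) * pi) * sin (of_int (p - q) * t)"
        by (simp add: cos_diff flip: cos_diff) (simp add: algebra_simps)
      moreover have "sin (of_int (p - q) * pi) = 0"
        unfolding sin_zero_iff_int2 by blast
      moreover have "cos (of_int (p - q) * pi) = (-1) powi (p + q)"
        using cos_npi_int[of "p - q"] by (simp add: power_int_minus_left mult.commute)
      ultimately show ?thesis by simp
    qed
    moreover have "bessel_J (p + q) (2 * r * cos (- t + pi)) = (-1) powi (p + q) * bessel_J (p + q) (2 * r * cos t)"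
    proof -
      have "bessel_J (p + q) (2 * r * cos (- t + pi)) = bessel_J (p + q) (- (2 * r * cos t))"
        by (simp add: cos_add)
      also have "\<dots> = (-1) powi (p + q) * bessel_J (p + q) (2 * r * cos t)"
        unfolding bessel_J_minus_arg bessel_J_minus ..
      finally show ?thesis .
    qed
    ultimately show ?thesis by (simp add: h_def power_int_minus_left)
  qed
  have "integral {pi / 2..pi} h = integral {- pi / 2..0} (\<lambda>t. h (t + pi))"
    using integral_shift_Icc_real[of "- pi / 2" 0 h pi] by (simp add: o_def add_ac)
  also have "\<dots> = integral {0..pi / 2} (\<lambda>t. h (- t + pi))"
    using Henstock_Kurzweil_Integration.integral_reflect_real[of "pi / 2" 0 "\<lambda>t. h (- t + pi)"] by simp
  finally have "integral {pi / 2..pi} h = integral {0..pi / 2} h"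
    by (simp only: mirror)
  moreover have "integral {0..pi / 2} h + integral {pi / 2..pi} h = integral {0..pi} h"
    by (rule Henstock_Kurzweil_Integration.integral_combine) (use int in auto)
  moreover have "integral {0..pi} h = pi * bessel_J p r * bessel_J q r"
    unfolding h_def by (rule integral_unique[OF bessel_J_product])
  ultimately have "integral {0..pi / 2} h = pi / 2 * bessel_J p r * bessel_J q r" by simp
  with integrable_integral[OF int, of 0 "pi / 2"]
  have "(h has_integral pi / 2 * bessel_J p r * bessel_J q r) {0..pi / 2}"
    by (simp only:)
  then show ?thesis unfolding h_def .
qed

subsection \<open>The Lerch transcendent on the closed unit disc\<close>

text \<open>Euler's integrand for Gamma (s) / a^s, extended by 0 so that all integrals run over the
  whole line.\<close>

definition gamma_kernel :: "real \<Rightarrow> real \<Rightarrow> real \<Rightarrow> real" where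
  "gamma_kernel s a t = indicator {0<..} t * (t powr (s - 1) * exp (- (a * t)))"

lemma gamma_kernel_nonneg: "gamma_kernel s a t \<ge> 0"
  by (simp add: gamma_kernel_def)

lemma borel_measurable_gamma_kernel [measurable]: "gamma_kernel s a \<in> borel_measurable borel"
  unfolding gamma_kernel_def by measurable

lemma gamma_kernel_mult_exp: "gamma_kernel s (a + b) t = gamma_kernel s a t * exp (- (b * t))"
  by (simp add: gamma_kernel_def distrib_right exp_add[symmetric])

lemma has_bochner_integral_gamma_kernel:
  assumes "s > 0" "a > 0"
  shows "has_bochner_integral lborel (gamma_kernel s a) (Gamma s / a powr s)"
proof -
  have 1: "has_bochner_integral lborel (gamma_kernel s 1) (Gamma s)"
  proof (rule has_bochner_integral_nn_integral)
    have "(\<integral>\<^sup>+ t. ennreal (gamma_kernel s 1 t) \<partial>lborel) =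
        (\<integral>\<^sup>+ t. ennreal (indicator {0..} t * t powr (s - 1) / exp t) \<partial>lborel)"
      by (intro nn_integral_cong) (auto simp: gamma_kernel_def indicator_def exp_minus field_simps)
    then show "(\<integral>\<^sup>+ t. ennreal (gamma_kernel s 1 t) \<partial>lborel) = ennreal (Gamma s)"
      using Gamma_conv_nn_integral_real[OF \<open>s > 0\<close>] by simp
  qed (use assms in \<open>auto simp: gamma_kernel_nonneg intro!: less_imp_le[OF Gamma_real_pos]\<close>)
  have "has_bochner_integral lborel (\<lambda>t. gamma_kernel s 1 (0 + a * t)) (Gamma s /\<^sub>R \<bar>a\<bar>)"
    using 1 lborel_has_bochner_integral_real_affine_iff[of a "gamma_kernel s 1" "Gamma s" 0] \<open>a > 0\<close> by simp
  then have "has_bochner_integral lborel (\<lambda>t. a powr (1 - s) * gamma_kernel s 1 (0 + a * t))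
      (a powr (1 - s) * (Gamma s /\<^sub>R \<bar>a\<bar>))"
    by (rule has_bochner_integral_mult_right)
  moreover have "a powr (1 - s) * gamma_kernel s 1 (0 + a * t) = gamma_kernel s a t" for t
  proof -
    have "a powr (1 - s) * a powr (s - 1) = 1"
      using \<open>a > 0\<close> by (simp flip: powr_add)
    then show ?thesis
      using \<open>a > 0\<close> by (simp add: gamma_kernel_def indicator_def powr_mult zero_less_mult_iff)
  qed
  moreover have "a powr (1 - s) * (Gamma s /\<^sub>R \<bar>a\<bar>) = Gamma s / a powr s"
    using \<open>a > 0\<close> by (simp add: powr_diff field_simps)
  ultimately show ?thesis by simp
qed

text \<open>The common estimate for integrals against the kernel. A bound on g for positive t
  suffices, since the kernel is 0 elsewhere.\<close>

lemma gamma_kernel_weighted: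
  fixes g :: "real \<Rightarrow> complex"
  assumes "s > 0" "a > 0" and g [measurable]: "g \<in> borel_measurable borel"
    and bound: "\<And>t. t > 0 \<Longrightarrow> norm (g t) \<le> C"
  shows gamma_kernel_weighted_integrable: "integrable lborel (\<lambda>t. of_real (gamma_kernel s a t) * g t)"
    and gamma_kernel_weighted_bound:
      "norm (\<integral>t. of_real (gamma_kernel s a t) * g t \<partial>lborel) \<le> C * (Gamma s / a powr s)"
proof -
  note k = has_bochner_integral_gamma_kernel[OF \<open>s > 0\<close> \<open>a > 0\<close>]
  have C: "has_bochner_integral lborel (\<lambda>t. C * gamma_kernel s a t) (C * (Gamma s / a powr s))"
    by (rule has_bochner_integral_mult_right) (use k in auto)
  have le: "norm (of_real (gamma_kernel s a t) * g t) \<le> C * gamma_kernel s a t" for t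
  proof (cases "t > 0")
    case True
    then show ?thesis
      using mult_right_mono[OF bound[OF True] gamma_kernel_nonneg[of s a t]]
      by (simp add: norm_mult gamma_kernel_nonneg mult.commute)
  qed (simp add: gamma_kernel_def)
  show *: "integrable lborel (\<lambda>t. of_real (gamma_kernel s a t) * g t)"
    by (rule Bochner_Integration.integrable_bound[OF integrable.intros[OF C]])
       (use le in \<open>auto intro: order_trans[OF _ abs_ge_self]\<close>)
  have "norm (\<integral>t. of_real (gamma_kernel s a t) * g t \<partial>lborel) \<le> (\<integral>t. C * gamma_kernel s a t \<partial>lborel)"
    by (rule Bochner_Integration.integral_norm_bound_integral[OF * integrable.intros[OF C] le])
  then show "norm (\<integral>t. of_real (gamma_kernel s a t) * g t \<partial>lborel) \<le> C * (Gamma s / a powr s)"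
    using has_bochner_integral_integral_eq[OF C] by simp
qed

section \<open>The integral representation and its agreement with series and continuation\<close>

definition lerch_integral :: "real \<Rightarrow> real \<Rightarrow> complex \<Rightarrow> complex" where
  "lerch_integral s a z =
     (\<integral>t. of_real (gamma_kernel s a t) * (1 / (1 - z * of_real (exp (- t)))) \<partial>lborel) / of_real (Gamma s)"

text \<open>By compactness of [0, 1] the modulus of 1 - z u attains its minimum. It is positive,
  since z u = 1 would put z = 1 / u on the cut. Half of it is taken as d: moving z by at most d
  changes the modulus by at most d.\<close>

lemma cut_plane_bound:
  assumes "z \<notin> complex_of_real ` {1..}"
  obtains d where "d > 0" "\<And>w u. dist z w \<le> d \<Longrightarrow> u \<in> {0..1} \<Longrightarrow> d \<le> norm (1 - w * of_real u)"
proof -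
  obtain u0 where u0: "u0 \<in> {0..1}"
    and min: "\<And>u. u \<in> {0..1} \<Longrightarrow> norm (1 - z * of_real u0) \<le> norm (1 - z * of_real u)"
  proof -
    have "continuous_on {0..1} (\<lambda>u. norm (1 - z * complex_of_real u))"
      by (intro continuous_intros)
    then show thesis
      using continuous_attains_inf[of "{0..1::real}" "\<lambda>u. norm (1 - z * complex_of_real u)"] that
      by fastforce
  qed
  have "1 - z * of_real u0 \<noteq> 0"
  proof
    assume "1 - z * of_real u0 = 0"
    then have z: "z * of_real u0 = 1" by simp
    then have "u0 \<noteq> 0" by auto
    with z have "z = of_real (1 / u0)" by (simp add: field_simps)
    moreover have "1 / u0 \<ge> 1" using u0 \<open>u0 \<noteq> 0\<close> by simp
    ultimately show False using assms by blast
  qed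
  define d where "d = norm (1 - z * of_real u0) / 2"
  have "d \<le> norm (1 - w * of_real u)" if w: "dist z w \<le> d" and u: "u \<in> {0..1}" for w u
  proof -
    have "2 * d \<le> norm (1 - z * of_real u)" using min[OF u] by (simp add: d_def)
    also have "1 - z * of_real u = (1 - w * of_real u) - (z - w) * of_real u"
      by (simp add: algebra_simps)
    also have "norm \<dots> \<le> norm (1 - w * of_real u) + norm (z - w) * \<bar>u\<bar>"
      by (metis norm_mult norm_of_real norm_triangle_ineq4)
    also have "norm (z - w) * \<bar>u\<bar> \<le> d * 1"
      using w u order_trans[OF zero_le_dist w] by (intro mult_mono) (auto simp: dist_norm)
    finally show ?thesis by simp
  qed
  moreover have "d > 0" using \<open>1 - z * of_real u0 \<noteq> 0\<close> by (simp add: d_def)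
  ultimately show thesis using that by blast
qed

text \<open>Differentiation under the integral sign: \<open>D\<close> integrates the z-derivative of
  the integrand. The difference quotient minus \<open>D\<close> is w - z times an integral with
  three denominators of modulus at least d, hence the constant 1 / d^3.\<close>

lemma lerch_integral_holomorphic:
  assumes "s > 0" "a > 0"
  shows "lerch_integral s a holomorphic_on (- complex_of_real ` {1..})"
proof (rule holomorphic_onI)
  fix z assume "z \<in> - complex_of_real ` {1..}"
  then obtain d where "d > 0"
    and d: "\<And>w u. dist z w \<le> d \<Longrightarrow> u \<in> {0..1} \<Longrightarrow> d \<le> norm (1 - w * complex_of_real u)"
    using cut_plane_bound by (metis ComplD)
  define I where "I g = (\<integral>t. of_real (gamma_kernel s a t) * g t \<partial>lborel)" for g :: "real \<Rightarrow> complex"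
  define q where "q w t = 1 - w * complex_of_real (exp (- t))" for w t
  define D where "D = I (\<lambda>t. of_real (exp (- t)) / q z t ^ 2)"
  have q [measurable]: "q w \<in> borel_measurable borel" for w unfolding q_def by measurable
  have dq: "d \<le> norm (q w t)" if "dist z w \<le> d" "t > 0" for w t
    unfolding q_def using that by (intro d) auto
  have "norm ((I (\<lambda>t. 1 / q w t) - I (\<lambda>t. 1 / q z t)) / (w - z) - D)
      \<le> norm (w - z) * (1 / d ^ 3 * (Gamma s / a powr s))"
    if "dist z w \<le> d" "w \<noteq> z" for w
  proof -
    have int1: "integrable lborel (\<lambda>t. of_real (gamma_kernel s a t) * (1 / q v t))"
      if "dist z v \<le> d" for v
      by (rule gamma_kernel_weighted_integrable[where C = "1 / d"])
         (use assms dq[OF that] \<open>d > 0\<close> in \<open>auto simp: norm_divide intro!: frac_le\<close>)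
    have int2: "integrable lborel (\<lambda>t. of_real (gamma_kernel s a t) * (of_real (exp (- t)) / q z t ^ 2))"
    proof (rule gamma_kernel_weighted_integrable[where C = "1 / d ^ 2"])
      show "norm (of_real (exp (- t)) / q z t ^ 2) \<le> 1 / d ^ 2" if "t > 0" for t
        using dq[of z t] that \<open>d > 0\<close>
        by (auto simp: norm_divide norm_power intro!: frac_le power_mono)
    qed (use assms in auto)
    have "(I (\<lambda>t. 1 / q w t) - I (\<lambda>t. 1 / q z t)) / (w - z) - D =
        (\<integral>t. (of_real (gamma_kernel s a t) * (1 / q w t) - of_real (gamma_kernel s a t) * (1 / q z t)) / (w - z)
          - of_real (gamma_kernel s a t) * (of_real (exp (- t)) / q z t ^ 2) \<partial>lborel)"
      unfolding I_def D_def using int1[of w] int1[of z] int2 \<open>d > 0\<close> that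
      by (simp add: Bochner_Integration.integral_diff)
    also have "\<dots> = (\<integral>t. of_real (gamma_kernel s a t) *
          ((w - z) * (of_real (exp (- t)) ^ 2 / (q w t * q z t ^ 2))) \<partial>lborel)"
    proof (rule Bochner_Integration.integral_cong)
      fix t :: real
      show "(of_real (gamma_kernel s a t) * (1 / q w t) - of_real (gamma_kernel s a t) * (1 / q z t)) / (w - z)
          - of_real (gamma_kernel s a t) * (of_real (exp (- t)) / q z t ^ 2) =
          of_real (gamma_kernel s a t) * ((w - z) * (of_real (exp (- t)) ^ 2 / (q w t * q z t ^ 2)))"
      \<comment> \<open>The denominators are controlled only for positive t; elsewhere the kernel
        makes both sides 0.\<close>
      proof (cases "t > 0")
        case True
        then have nz: "q w t \<noteq> 0" "q z t \<noteq> 0"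
          using dq[of w t] dq[of z t] that \<open>d > 0\<close> by auto
        have "1 / q w t - 1 / q z t = (w - z) * (of_real (exp (- t)) / (q w t * q z t))"
          using nz by (simp add: q_def divide_simps) (simp add: algebra_simps)
        then have e1: "(1 / q w t - 1 / q z t) / (w - z) = of_real (exp (- t)) / (q w t * q z t)"
          using that by simp
        have e2: "of_real (exp (- t)) / (q w t * q z t) - of_real (exp (- t)) / q z t ^ 2 =
            (w - z) * (of_real (exp (- t)) ^ 2 / (q w t * q z t ^ 2))"
          using nz by (simp add: divide_simps power2_eq_square) (simp add: q_def algebra_simps)
        show ?thesis
          unfolding e2[symmetric] e1[symmetric] by (simp add: field_simps)
      qed (simp add: gamma_kernel_def)
    qed simp
    also have "\<dots> = (w - z) * I (\<lambda>t. of_real (exp (- t)) ^ 2 / (q w t * q z t ^ 2))"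
      unfolding I_def by (subst Bochner_Integration.integral_mult_right_zero[symmetric]) (simp only: mult_ac)
    also have "norm \<dots> \<le> norm (w - z) * (1 / d ^ 3 * (Gamma s / a powr s))"
      unfolding norm_mult I_def
    proof (intro mult_left_mono gamma_kernel_weighted_bound)
      fix t :: real assume "t > 0"
      then have "d * d ^ 2 \<le> norm (q w t) * norm (q z t) ^ 2"
        using dq[of w t] dq[of z t] that \<open>d > 0\<close> by (intro mult_mono power_mono) auto
      then show "norm (of_real (exp (- t)) ^ 2 / (q w t * q z t ^ 2)) \<le> 1 / d ^ 3"
        using \<open>t > 0\<close> \<open>d > 0\<close>
        by (auto simp: norm_divide norm_mult norm_power power3_eq_cube power2_eq_square mult.assoc
            intro!: frac_le mult_le_one)
    qed (use assms in auto)
    finally show ?thesis .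
  qed
  then have ev: "eventually (\<lambda>w. norm ((I (\<lambda>t. 1 / q w t) - I (\<lambda>t. 1 / q z t)) / (w - z) - D)
      \<le> norm (w - z) * (1 / d ^ 3 * (Gamma s / a powr s))) (at z)"
    unfolding eventually_at using \<open>d > 0\<close> by (intro exI[of _ d]) (auto simp: dist_commute)
  have "((\<lambda>w. norm (w - z) * (1 / d ^ 3 * (Gamma s / a powr s))) \<longlongrightarrow> norm (z - z) * (1 / d ^ 3 * (Gamma s / a powr s))) (at z)"
    by (intro tendsto_intros)
  then have "((\<lambda>w. (I (\<lambda>t. 1 / q w t) - I (\<lambda>t. 1 / q z t)) / (w - z) - D) \<longlongrightarrow> 0) (at z)"
    by (intro Lim_null_comparison[OF ev]) simp
  then have "((\<lambda>w. I (\<lambda>t. 1 / q w t)) has_field_derivative D) (at z)"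
    unfolding has_field_derivative_iff by (simp add: LIM_zero_iff)
  then have "((\<lambda>w. I (\<lambda>t. 1 / q w t) / of_real (Gamma s)) has_field_derivative D / of_real (Gamma s)) (at z)"
    by (rule DERIV_cdivide)
  moreover have "(\<lambda>w. I (\<lambda>t. 1 / q w t) / of_real (Gamma s)) = lerch_integral s a"
    unfolding I_def q_def lerch_integral_def ..
  ultimately have "(lerch_integral s a has_field_derivative D / of_real (Gamma s))
      (at z within - complex_of_real ` {1..})"
    using has_field_derivative_at_within by metis
  then show "lerch_integral s a field_differentiable at z within - complex_of_real ` {1..}"
    unfolding field_differentiable_def by blast
qed

text \<open>With q = z e^(-t), the finite geometric identity for 1 / (1 - q) with remainder q^N / (1
  - q) is integrated term by term; a factor e^(- n t) raises the parameter a of the kernel by n. As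
  the identity is finite, z may be any point off the cut.\<close>

lemma lerch_integral_remainder:
  assumes "s > 0" "a > 0" and z: "z \<notin> complex_of_real ` {1..}"
  shows "lerch_integral s a z - (\<Sum>n<N. z ^ n / of_real ((a + real n) powr s)) =
    (\<integral>t. of_real (gamma_kernel s (a + real N) t) * (z ^ N / (1 - z * of_real (exp (- t)))) \<partial>lborel)
      / of_real (Gamma s)"
proof -
  obtain d where "d > 0" and d': "\<And>w u. dist z w \<le> d \<Longrightarrow> u \<in> {0..1} \<Longrightarrow> d \<le> norm (1 - w * complex_of_real u)"
    using cut_plane_bound[OF z] by blast
  have d: "d \<le> norm (1 - z * complex_of_real (exp (- t)))" if "t > 0" for t
    using d'[of z "exp (- t)"] \<open>d > 0\<close> that by simp
  have summand: "has_bochner_integral lborel (\<lambda>t. z ^ n * of_real (gamma_kernel s (a + real n) t))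
      (z ^ n * of_real (Gamma s / (a + real n) powr s))" for n
    by (intro has_bochner_integral_mult_right has_bochner_integral_of_real has_bochner_integral_gamma_kernel)
       (use assms in auto)
  have int: "integrable lborel (\<lambda>t. of_real (gamma_kernel s (a + real N) t) * (z ^ N / (1 - z * of_real (exp (- t)))))"
    by (rule gamma_kernel_weighted_integrable[where C = "norm (z ^ N) / d"])
       (use assms d \<open>d > 0\<close> in \<open>auto simp: norm_divide intro!: frac_le\<close>)
  have Gs: "Gamma s \<noteq> 0" using Gamma_real_pos[OF \<open>s > 0\<close>] by simp
  have "of_real (gamma_kernel s a t) * (1 / (1 - z * of_real (exp (- t)))) =
      (\<Sum>n<N. z ^ n * of_real (gamma_kernel s (a + real n) t)) +
      of_real (gamma_kernel s (a + real N) t) * (z ^ N / (1 - z * of_real (exp (- t))))" for t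
  proof (cases "t > 0")
    case True
    let ?q = "z * complex_of_real (exp (- t))"
    have "1 - ?q \<noteq> 0" using d[OF True] \<open>d > 0\<close> by auto
    moreover have "1 / (1 - q) = (\<Sum>n<N. q ^ n) + q ^ N / (1 - q)" if "1 - q \<noteq> 0" for q :: complex
      using that by (simp add: sum_gp_strict add_divide_distrib[symmetric])
    ultimately have "1 / (1 - ?q) = (\<Sum>n<N. ?q ^ n) + ?q ^ N / (1 - ?q)" by blast
    moreover have "complex_of_real (gamma_kernel s (a + real n) t) =
        of_real (gamma_kernel s a t) * of_real (exp (- t)) ^ n" for n
      by (simp add: gamma_kernel_mult_exp exp_of_nat_mult[symmetric] flip: of_real_power)
    ultimately show ?thesis
      by (simp add: distrib_left sum_distrib_left power_mult_distrib mult_ac)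
  qed (simp add: gamma_kernel_def)
  then have "(\<integral>t. of_real (gamma_kernel s a t) * (1 / (1 - z * of_real (exp (- t)))) \<partial>lborel) =
      (\<Sum>n<N. z ^ n * of_real (Gamma s / (a + real n) powr s)) +
      (\<integral>t. of_real (gamma_kernel s (a + real N) t) * (z ^ N / (1 - z * of_real (exp (- t)))) \<partial>lborel)"
    using int summand by (simp add: has_bochner_integral_iff)
  then show ?thesis
    using Gs by (simp add: lerch_integral_def add_divide_distrib sum_divide_distrib)
qed

lemma unit_disc_cut_plane:
  assumes "norm z \<le> 1" "z \<noteq> 1"
  shows "z \<notin> complex_of_real ` {1..}"
  using assms by auto

text \<open>On the closed disc z^N is bounded by 1, so the remainder is at most (a + N)^(-s) / d and
  tends to 0. This includes boundary points at which, for s \<le> 1, convergence is only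
  conditional.\<close>

lemma lerch_integral_sums:
  assumes "s > 0" "a > 0" "norm z \<le> 1" "z \<noteq> 1"
  shows "(\<lambda>n. z ^ n / of_real ((a + real n) powr s)) sums lerch_integral s a z"
proof -
  note cut = unit_disc_cut_plane[OF assms(3,4)]
  obtain d where "d > 0" and d: "\<And>w u. dist z w \<le> d \<Longrightarrow> u \<in> {0..1} \<Longrightarrow> d \<le> norm (1 - w * complex_of_real u)"
    using cut_plane_bound[OF cut] by blast
  have G: "Gamma s > 0" using Gamma_real_pos[OF \<open>s > 0\<close>] .
  have "norm ((\<Sum>n<N. z ^ n / of_real ((a + real n) powr s)) - lerch_integral s a z)
      \<le> 1 / d * (a + real N) powr (- s)" for N
  proof -
    have "norm (\<integral>t. of_real (gamma_kernel s (a + real N) t) * (z ^ N / (1 - z * of_real (exp (- t)))) \<partial>lborel)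
        \<le> 1 / d * (Gamma s / (a + real N) powr s)"
    proof (rule gamma_kernel_weighted_bound)
      fix t :: real assume "t > 0"
      then show "norm (z ^ N / (1 - z * of_real (exp (- t)))) \<le> 1 / d"
        using d[of z "exp (- t)"] \<open>d > 0\<close> assms
        by (auto simp: norm_divide norm_power intro!: frac_le power_le_one)
    qed (use assms in auto)
    then have "norm (lerch_integral s a z - (\<Sum>n<N. z ^ n / of_real ((a + real n) powr s)))
        \<le> 1 / d * (Gamma s / (a + real N) powr s) / Gamma s"
      unfolding lerch_integral_remainder[OF assms(1,2) cut] norm_divide norm_of_real abs_of_pos[OF G]
      by (rule divide_right_mono) (use G in simp)
    also have "1 / d * (Gamma s / (a + real N) powr s) / Gamma s = 1 / d * (a + real N) powr (- s)"
      using G by (simp add: powr_minus_divide)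
    finally show ?thesis by (simp only: norm_minus_commute)
  qed
  note bound = this
  have "(\<lambda>N. 1 / d * (a + real N) powr (- s)) \<longlonglongrightarrow> 1 / d * 0"
    by (intro tendsto_mult tendsto_const tendsto_neg_powr filterlim_tendsto_add_at_top[OF tendsto_const]
        filterlim_real_sequentially) (use assms in auto)
  then have "(\<lambda>N. (\<Sum>n<N. z ^ n / of_real ((a + real n) powr s)) - lerch_integral s a z) \<longlonglongrightarrow> 0"
    unfolding mult_zero_right by (rule Lim_null_comparison[OF always_eventually, rotated]) (use bound in blast)
  then show ?thesis unfolding sums_def by (rule LIM_zero_cancel)
qed

text \<open>\<open>lerch_integral\<close> witnesses that the choice in
  \<open>lerch_continuation\<close> has a solution. The chosen function agrees with it inside the
  disc, and both are continuous on the cut plane, so their limits along the radius to z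
  coincide.\<close>

lemma lerch_continuation_unit_disc:
  assumes "s > 0" "a > 0" "norm z \<le> 1" "z \<noteq> 1"
  shows "lerch_continuation s a z = lerch_integral s a z"
proof -
  let ?P = "\<lambda>f. f holomorphic_on (- complex_of_real ` {1..}) \<and>
      (\<forall>z. norm z < 1 \<longrightarrow> f z = lerch_series z s a)"
  have disc: "lerch_integral s a w = lerch_series w s a" if "norm w < 1" for w
    unfolding lerch_series_def
    by (rule sums_unique[OF lerch_integral_sums]) (use assms(1,2) that in auto)
  have "?P (lerch_integral s a)"
    using lerch_integral_holomorphic[OF assms(1,2)] disc by blast
  then have P: "?P (lerch_continuation s a)"
    unfolding lerch_continuation_def by (rule someI[of ?P])
  have lim: "((\<lambda>x. of_real x * z) \<longlongrightarrow> of_real 1 * z) (at_left (1::real))"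
    by (intro tendsto_intros)
  have small: "\<forall>\<^sub>F x in at_left (1::real). norm (of_real x * z) < 1"
  proof -
    have "norm (of_real x * z) < 1" if "0 < x" "x < 1" for x
    proof -
      have "norm (of_real x * z) = x * norm z" using that by (simp add: norm_mult)
      also have "\<dots> \<le> x * 1" using that assms by (intro mult_left_mono) auto
      finally show ?thesis using that by simp
    qed
    then show ?thesis unfolding eventually_at_left_field by (intro exI[of _ 0]) auto
  qed
  have ev: "\<forall>\<^sub>F x in at_left (1::real). of_real x * z \<in> - complex_of_real ` {1..}"
    using small by eventually_elim auto
  have tends: "((\<lambda>x. f (of_real x * z)) \<longlongrightarrow> f z) (at_left 1)"
    if "f holomorphic_on (- complex_of_real ` {1..})" for f
    using continuous_on_tendsto_compose[OF holomorphic_on_imp_continuous_on[OF that] lim _ ev]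
      unit_disc_cut_plane[OF assms(3,4)] by simp
  have "((\<lambda>x. lerch_continuation s a (of_real x * z)) \<longlongrightarrow> lerch_integral s a z) (at_left 1)"
    by (rule Lim_transform_eventually[OF tends[OF lerch_integral_holomorphic[OF assms(1,2)]]])
       (use small in eventually_elim, use P disc in auto)
  moreover have "((\<lambda>x. lerch_continuation s a (of_real x * z)) \<longlongrightarrow> lerch_continuation s a z) (at_left 1)"
    using P by (intro tends) auto
  ultimately show ?thesis
    by (intro tendsto_unique[OF trivial_limit_at_left_real])
qed

text \<open>On this set both branches of \<open>lerch_Phi\<close> take the value of
  \<open>lerch_integral\<close>, so the case distinction of the definition disappears.\<close>

lemma lerch_Phi_sums:
  assumes "s > 0" "a > 0" "norm z \<le> 1" "z \<noteq> 1"
  shows "(\<lambda>n. z ^ n / of_real ((a + real n) powr s)) sums lerch_Phi z s a"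
  using lerch_integral_sums[OF assms] lerch_continuation_unit_disc[OF assms]
  by (auto simp: lerch_Phi_def lerch_series_def sums_iff)

section \<open>Bounds uniform in the number of summands\<close>

text \<open>The second bound follows from the first: 1 - z differs from 1 - z u by z (1 - u), whose
  modulus is at most 1 - u.\<close>

lemma norm_one_minus_mult_ge:
  fixes z :: complex
  assumes "norm z \<le> 1" "0 \<le> u" "u \<le> 1"
  shows "1 - u \<le> norm (1 - z * of_real u)" "norm (1 - z) \<le> 2 * norm (1 - z * of_real u)"
proof -
  have "norm (z * of_real u) \<le> 1 * u"
    unfolding norm_mult using assms by (intro mult_mono) auto
  then show 1: "1 - u \<le> norm (1 - z * of_real u)"
    using norm_triangle_ineq2[of 1 "z * of_real u"] by simp
  have "1 - z = (1 - z * of_real u) - z * of_real (1 - u)" by (simp add: algebra_simps)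
  then have "norm (1 - z) \<le> norm (1 - z * of_real u) + norm (z * of_real (1 - u))"
    by (metis norm_triangle_ineq4)
  also have "norm (z * of_real (1 - u)) \<le> 1 * (1 - u)"
    unfolding norm_mult norm_of_real using assms by (intro mult_mono) auto
  finally show "norm (1 - z) \<le> 2 * norm (1 - z * of_real u)" using 1 by simp
qed

text \<open>
  Interpolating between the two bounds of \<open>norm_one_minus_mult_ge\<close> trades a small power of \<open>t\<close>,
  which the Gamma integral absorbs, against an exponent of \<open>norm (1 - z)\<close> above \<open>-1\<close>.
\<close>
lemma lerch_partial_sum_bound:
  assumes "s > 0" "a > 0"
  obtains C p where "C \<ge> 0" "0 < p" "p < 1"
    "\<And>z N. norm z \<le> 1 \<Longrightarrow> z \<noteq> 1 \<Longrightarrow>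
       norm (\<Sum>n<N. z ^ n / complex_of_real ((a + real n) powr s)) \<le> C * norm (1 - z) powr (- p)"
proof -
  \<comment> \<open>Since \<open>e\<close> is below s, a and 1, the kernel with both parameters
    lowered by \<open>e\<close> still has a finite integral, and p = 1 - e lies strictly between 0
    and 1.\<close>
  define e where "e = min (min s a) 1 / 2"
  have e: "0 < e" "e < s" "e < a" "e < 1" using assms by (auto simp: e_def min_def)
  define C where "C = 2 * 2 powr (1 - e) * (Gamma (s - e) / (a - e) powr (s - e)) / Gamma s"
  have G: "Gamma s > 0" "Gamma (s - e) > 0" using Gamma_real_pos e assms by auto
  have "norm (\<Sum>n<N. z ^ n / complex_of_real ((a + real n) powr s)) \<le> C * norm (1 - z) powr (- (1 - e))"
    if z: "norm z \<le> 1" "z \<noteq> 1" for z N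
  proof -
    define q where "q t = 1 - z * complex_of_real (exp (- t))" for t
    have [measurable]: "q \<in> borel_measurable borel" unfolding q_def by measurable
    define B where "B = (norm (1 - z) / 2) powr (- (1 - e)) * (Gamma (s - e) / (a - e) powr (s - e))"
    have bound: "norm (\<integral>t. of_real (gamma_kernel s (a + real M) t) * (z ^ M / q t) \<partial>lborel) \<le> B" for M
    proof -
      \<comment> \<open>The factor (t e^(-t))^e is moved from the kernel into the weight, which
        lowers both kernel parameters by \<open>e\<close>; the factor e^(- M t) moves along.\<close>
      have "of_real (gamma_kernel s (a + real M) t) * (z ^ M / q t) =
          of_real (gamma_kernel (s - e) (a - e) t) *
            (of_real ((t * exp (- t)) powr e * exp (- (real M * t))) * z ^ M / q t)" (is "?l t = ?r t") for t
      proof (cases "t > 0")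
        case True
        have "gamma_kernel s (a + real M) t =
            gamma_kernel (s - e) (a - e) t * ((t * exp (- t)) powr e * exp (- (real M * t)))"
        proof -
          have "t powr (s - 1) = t powr (s - e - 1) * t powr e"
            by (simp flip: powr_add)
          moreover have "exp (- ((a + real M) * t)) = exp (- ((a - e) * t)) * exp (- (e * t)) * exp (- (real M * t))"
            unfolding exp_add[symmetric] by (simp add: algebra_simps)
          moreover have "(t * exp (- t)) powr e = t powr e * exp (- (e * t))"
            using True by (simp add: powr_mult powr_def[of "exp (- t)"])
          ultimately show ?thesis by (simp add: gamma_kernel_def)
        qed
        then show ?thesis by simp
      qed (simp add: gamma_kernel_def)
      then have "norm (integral\<^sup>L lborel ?l) = norm (integral\<^sup>L lborel ?r)"
        by (simp only:)
      also have "\<dots> \<le> B" unfolding B_def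
      proof (rule gamma_kernel_weighted_bound)
        fix t :: real assume "t > 0"
        \<comment> \<open>This is 1 + t \<le> e^t. It bounds the weight by a power of the modulus of
          \<open>q t\<close> with exponent e - 1; as this exponent is negative, the lower bound by
          half the modulus of 1 - z applies.\<close>
        have "t * exp (- t) \<le> 1 - exp (- t)"
          using exp_ge_add_one_self[of t] by (simp add: exp_minus field_simps)
        also have "\<dots> \<le> norm (q t)"
          unfolding q_def using z \<open>t > 0\<close> by (intro norm_one_minus_mult_ge) auto
        finally have 1: "t * exp (- t) \<le> norm (q t)" .
        have 2: "norm (1 - z) / 2 \<le> norm (q t)"
          unfolding q_def using norm_one_minus_mult_ge(2)[of z "exp (- t)"] z \<open>t > 0\<close> by simp
        have 3: "0 < norm (1 - z) / 2" using z by simp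
        then have q0: "norm (q t) > 0" using 2 by linarith
        have "norm (of_real ((t * exp (- t)) powr e * exp (- (real M * t))) * z ^ M / q t) =
            (t * exp (- t)) powr e * exp (- (real M * t)) * norm z ^ M / norm (q t)"
          using \<open>t > 0\<close> by (simp add: norm_mult norm_divide norm_power)
        also have "\<dots> \<le> norm (q t) powr e * 1 * 1 / norm (q t)"
          using 1 z e \<open>t > 0\<close>
          by (intro divide_right_mono mult_mono powr_mono2 power_le_one) auto
        also have "\<dots> = norm (q t) powr (- (1 - e))"
          using q0 by (simp add: powr_diff)
        also have "\<dots> \<le> (norm (1 - z) / 2) powr (- (1 - e))"
          using 2 3 e by (intro powr_mono2') auto
        finally show "norm (of_real ((t * exp (- t)) powr e * exp (- (real M * t))) * z ^ M / q t)
            \<le> (norm (1 - z) / 2) powr (- (1 - e))" .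
      qed (use e in auto)
      finally show ?thesis .
    qed
    note cut = unit_disc_cut_plane[OF z]
    \<comment> \<open>A partial sum is the remainder after 0 terms minus that after N terms, and the
      bound \<open>B\<close> for both is independent of N.\<close>
    have "(\<Sum>n<N. z ^ n / complex_of_real ((a + real n) powr s)) =
        (\<integral>t. of_real (gamma_kernel s (a + real 0) t) * (z ^ 0 / q t) \<partial>lborel) / of_real (Gamma s) -
        (\<integral>t. of_real (gamma_kernel s (a + real N) t) * (z ^ N / q t) \<partial>lborel) / of_real (Gamma s)"
      using lerch_integral_remainder[OF assms cut, of N] lerch_integral_remainder[OF assms cut, of 0]
      by (simp add: q_def algebra_simps)
    also have "norm \<dots> \<le> B / Gamma s + B / Gamma s"
    proof -
      have "norm ((\<integral>t. of_real (gamma_kernel s (a + real M) t) * (z ^ M / q t) \<partial>lborel) / of_real (Gamma s))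
          \<le> B / Gamma s" for M
        unfolding norm_divide norm_of_real abs_of_pos[OF G(1)]
        by (rule divide_right_mono[OF bound]) (use G in simp)
      then show ?thesis by (intro order_trans[OF norm_triangle_ineq4 add_mono])
    qed
    also have "\<dots> = C * norm (1 - z) powr (- (1 - e))"
    proof -
      have half: "(x / 2) powr (- p) = x powr (- p) * 2 powr p" if "x \<ge> 0" for x p :: real
        using powr_divide[of x 2 "- p"] that by (simp add: powr_minus_divide[of 2])
      have arith: "x * y * k / g + x * y * k / g = 2 * y * k / g * x" for x y k g :: real
        by simp
      show ?thesis unfolding B_def C_def half[OF norm_ge_zero] by (rule arith)
    qed
    finally show ?thesis .
  qed
  moreover have "C \<ge> 0" using G by (simp add: C_def)
  ultimately show thesis using e by (intro that[of C "1 - e"]) auto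
qed

subsection \<open>Termwise integration against the Lerch kernel\<close>

text \<open>Summand of the cosine series of \<open>lerch_F\<close>. The index starts at 0, so
  \<open>Suc l\<close> is the summation index of the theorem.\<close>

definition lerch_cos_term :: "real \<Rightarrow> real \<Rightarrow> int \<Rightarrow> nat \<Rightarrow> real \<Rightarrow> real" where
  "lerch_cos_term s \<beta> \<mu> l \<phi> =
     (-1) ^ Suc l * cos (of_int (\<mu> + 2 * int (Suc l)) * \<phi>) / (real (Suc l) + \<beta>) powr s"

lemma norm_one_plus_cis_double: "norm (1 + cis (2 * \<phi>)) = 2 * \<bar>cos \<phi>\<bar>"
proof -
  have "1 + cis (2 * \<phi>) = of_real (2 * cos \<phi>) * cis \<phi>"
    by (simp add: complex_eq_iff cos_double_cos sin_double power2_eq_square)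
  then show ?thesis by (simp add: norm_mult)
qed

lemma lerch_F_cis:
  "lerch_F a \<beta> \<mu> \<phi> = - (1 / 2) * (cis (of_int (\<mu> + 2) * \<phi>) * lerch_Phi (- cis (2 * \<phi>)) a (\<beta> + 1)
      + cis (- (of_int (\<mu> + 2) * \<phi>)) * lerch_Phi (- cis (- (2 * \<phi>))) a (\<beta> + 1))"
proof -
  have "exp (- (\<i> * of_real \<phi> * of_int (\<mu> + 2))) = cis (- (of_int (\<mu> + 2) * \<phi>))"
    "exp (2 * \<i> * of_real \<phi> * of_int (\<mu> + 2)) = cis (2 * (of_int (\<mu> + 2) * \<phi>))"
    "exp (2 * \<i> * of_real \<phi>) = cis (2 * \<phi>)" "exp (- (2 * \<i> * of_real \<phi>)) = cis (- (2 * \<phi>))"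
    by (simp_all add: cis_conv_exp mult_ac)
  then have "lerch_F a \<beta> \<mu> \<phi> = - (1 / 2) * ((cis (- (of_int (\<mu> + 2) * \<phi>)) * cis (2 * (of_int (\<mu> + 2) * \<phi>)))
        * lerch_Phi (- cis (2 * \<phi>)) a (\<beta> + 1)
      + cis (- (of_int (\<mu> + 2) * \<phi>)) * lerch_Phi (- cis (- (2 * \<phi>))) a (\<beta> + 1))"
    unfolding lerch_F_def by (simp only: distrib_left mult.assoc)
  moreover have "cis (- x) * cis (2 * x) = cis x" for x
    by (simp add: cis_mult)
  ultimately show ?thesis by (simp only:)
qed

text \<open>The two exponentials of the cosine belong to the two Lerch series in
  \<open>lerch_F\<close>. The exponent \<open>Suc l\<close> of the sign absorbs the minus in front
  of 1/2.\<close>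

lemma lerch_cos_term_cis:
  "complex_of_real (lerch_cos_term s \<beta> \<mu> l \<phi>) =
     - (1 / 2) * (cis (of_int (\<mu> + 2) * \<phi>) * ((- cis (2 * \<phi>)) ^ l / of_real ((\<beta> + 1 + real l) powr s))
      + cis (- (of_int (\<mu> + 2) * \<phi>)) * ((- cis (- (2 * \<phi>))) ^ l / of_real ((\<beta> + 1 + real l) powr s)))"
proof -
  have pow: "(- cis \<psi>) ^ l = (-1) ^ l * cis (real l * \<psi>)" for \<psi>
    by (metis Complex.DeMoivre power_minus)
  have cos: "cis x + cis (- x) = of_real (2 * cos x)" for x
    by (simp add: complex_eq_iff)
  have "cis (of_int (\<mu> + 2) * \<phi>) * ((- cis (2 * \<phi>)) ^ l / of_real ((\<beta> + 1 + real l) powr s))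
      + cis (- (of_int (\<mu> + 2) * \<phi>)) * ((- cis (- (2 * \<phi>))) ^ l / of_real ((\<beta> + 1 + real l) powr s)) =
      (-1) ^ l * (cis (of_int (\<mu> + 2) * \<phi>) * cis (real l * (2 * \<phi>)) +
        cis (- (of_int (\<mu> + 2) * \<phi>)) * cis (real l * (- (2 * \<phi>)))) / of_real ((\<beta> + 1 + real l) powr s)"
    unfolding pow by (simp add: add_divide_distrib distrib_left mult_ac)
  also have "cis (of_int (\<mu> + 2) * \<phi>) * cis (real l * (2 * \<phi>)) +
        cis (- (of_int (\<mu> + 2) * \<phi>)) * cis (real l * (- (2 * \<phi>))) =
      of_real (2 * cos (of_int (\<mu> + 2 * int (Suc l)) * \<phi>))"
    unfolding cis_mult cos[symmetric] by (simp add: algebra_simps)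
  finally show ?thesis
    by (simp add: lerch_cos_term_def add_ac)
qed

lemma minus_cis_double_unit_disc:
  assumes "cos \<phi> \<noteq> 0"
  shows "norm (- cis (2 * \<phi>)) \<le> 1" "- cis (2 * \<phi>) \<noteq> 1"
proof -
  show "- cis (2 * \<phi>) \<noteq> 1"
  proof
    assume "- cis (2 * \<phi>) = 1"
    then have "1 + cis (2 * \<phi>) = 0" by (metis add.left_inverse add.commute minus_minus)
    then show False using assms norm_one_plus_cis_double[of \<phi>] by simp
  qed
qed simp

lemma lerch_F_sums:
  assumes "s > 0" "\<beta> > -1" "cos \<phi> \<noteq> 0"
  shows "(\<lambda>l. complex_of_real (lerch_cos_term s \<beta> \<mu> l \<phi>)) sums lerch_F s \<beta> \<mu> \<phi>"
  unfolding lerch_F_cis lerch_cos_term_cis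
  using assms minus_cis_double_unit_disc[of \<phi>] minus_cis_double_unit_disc[of "- \<phi>"]
  by (intro sums_mult sums_add lerch_Phi_sums) auto

text \<open>\<open>lerch_partial_sum_bound\<close> is applied at the points - e^(2i\<phi>) and -
  e^(-2i\<phi>), whose distance to 1 is twice the modulus of cos \<phi>. The constants are uniform
  in \<mu>, which enters only through factors of modulus 1.\<close>

lemma lerch_cos_partial_sum_bound:
  assumes "s > 0" "\<beta> > -1"
  obtains C p where "C \<ge> 0" "0 < p" "p < 1"
    "\<And>\<mu> N \<phi>. cos \<phi> \<noteq> 0 \<Longrightarrow>
       \<bar>\<Sum>l<N. lerch_cos_term s \<beta> \<mu> l \<phi>\<bar> \<le> C * \<bar>cos \<phi>\<bar> powr (- p)"
proof -
  obtain C p where C: "C \<ge> 0" and p: "0 < p" "p < 1"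
    and bound: "\<And>z N. norm z \<le> 1 \<Longrightarrow> z \<noteq> 1 \<Longrightarrow>
       norm (\<Sum>n<N. z ^ n / complex_of_real ((\<beta> + 1 + real n) powr s)) \<le> C * norm (1 - z) powr (- p)"
    using lerch_partial_sum_bound[of s "\<beta> + 1"] assms by auto
  have "\<bar>\<Sum>l<N. lerch_cos_term s \<beta> \<mu> l \<phi>\<bar> \<le> (C * 2 powr (- p)) * \<bar>cos \<phi>\<bar> powr (- p)"
    if "cos \<phi> \<noteq> 0" for \<mu> N \<phi>
  proof -
    define S where "S \<psi> = (\<Sum>n<N. (- cis (2 * \<psi>)) ^ n / complex_of_real ((\<beta> + 1 + real n) powr s))" for \<psi>
    have S: "norm (S \<psi>) \<le> C * (2 * \<bar>cos \<phi>\<bar>) powr (- p)" if "cos \<psi> = cos \<phi>" for \<psi>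
    proof -
      have "norm (S \<psi>) \<le> C * norm (1 - - cis (2 * \<psi>)) powr (- p)"
        unfolding S_def using minus_cis_double_unit_disc[of \<psi>] that \<open>cos \<phi> \<noteq> 0\<close> by (intro bound) auto
      then show ?thesis using norm_one_plus_cis_double[of \<psi>] that by simp
    qed
    have "complex_of_real (\<Sum>l<N. lerch_cos_term s \<beta> \<mu> l \<phi>) =
        - (1 / 2) * (cis (of_int (\<mu> + 2) * \<phi>) * S \<phi> + cis (- (of_int (\<mu> + 2) * \<phi>)) * S (- \<phi>))"
      unfolding S_def of_real_sum lerch_cos_term_cis sum_distrib_left sum.distrib[symmetric]
      by (simp add: sum_distrib_left sum.distrib)
    then have "norm (complex_of_real (\<Sum>l<N. lerch_cos_term s \<beta> \<mu> l \<phi>)) \<le>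
        1 / 2 * (norm (S \<phi>) + norm (S (- \<phi>)))"
      using norm_triangle_ineq[of "cis (of_int (\<mu> + 2) * \<phi>) * S \<phi>" "cis (- (of_int (\<mu> + 2) * \<phi>)) * S (- \<phi>)"]
      by (simp add: norm_mult)
    also have "\<dots> \<le> C * (2 * \<bar>cos \<phi>\<bar>) powr (- p)"
      using S[of \<phi>] S[of "- \<phi>"] by simp
    finally show ?thesis unfolding norm_of_real by (simp add: powr_mult mult.assoc)
  qed
  moreover have "C * 2 powr (- p) \<ge> 0" using C by simp
  ultimately show thesis using p that by blast
qed

section \<open>Integrating through the singularity at pi / 2\<close>

text \<open>The mean value theorem gives (x/2) cos (x/2) \<le> sin (x/2). Multiplied by 2 cos (x/2)
  this becomes (x/2) (1 + cos x) \<le> sin x, and cos x is nonnegative here.\<close>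

lemma sin_ge_half:
  assumes "0 \<le> x" "x \<le> pi / 2"
  shows "x / 2 \<le> sin (x::real)"
proof -
  have "x / 2 * cos (x / 2) \<le> sin (x / 2)"
  proof (cases "x = 0")
    case False
    then have "\<exists>z>0. z < x / 2 \<and> sin (x / 2) - sin 0 = (x / 2 - 0) * cos z"
      using assms by (intro MVT2) (auto intro!: derivative_eq_intros)
    then obtain z where z: "0 < z" "z < x / 2" "sin (x / 2) = x / 2 * cos z" by auto
    have "cos (x / 2) \<le> cos z"
      using z assms by (intro cos_monotone_0_pi_le) auto
    then show ?thesis using z assms by (simp add: mult_left_mono)
  qed simp
  moreover have "cos (x / 2) \<ge> 0" using assms by (intro cos_ge_zero) auto
  ultimately have "x / 2 * cos (x / 2) * cos (x / 2) \<le> sin (x / 2) * cos (x / 2)"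
    by (rule mult_right_mono)
  moreover have "2 * (sin (x / 2) * cos (x / 2)) = sin x"
    using sin_double[of "x / 2"] by simp
  moreover have "2 * (cos (x / 2) * cos (x / 2)) = 1 + cos x"
    using cos_double_cos[of "x / 2"] by (simp add: power2_eq_square)
  then have "2 * (x / 2 * cos (x / 2) * cos (x / 2)) = x / 2 * (1 + cos x)" by algebra
  moreover have "x / 2 * 1 \<le> x / 2 * (1 + cos x)"
    using assms cos_ge_zero[of x] by (intro mult_left_mono) auto
  ultimately show ?thesis by linarith
qed

text \<open>The modulus of cos \<phi> is the sine of the distance x from \<phi> to pi / 2, hence at
  least x / 2, and x^(-p) is integrable at 0 for p < 1.\<close>

lemma integrable_abs_cos_powr:
  assumes "0 < p" "p < 1"
  shows "set_integrable lborel {0..pi} (\<lambda>\<phi>. \<bar>cos \<phi>\<bar> powr (- p))"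
proof -
  define K where "K x = indicator {0..pi / 2} x * (x / 2) powr (- p)" for x :: real
  have [measurable]: "K \<in> borel_measurable borel" unfolding K_def by measurable
  have "(\<lambda>x. x powr (- p)) integrable_on {0..pi / 2}"
    using assms by (intro integrable_on_powr_from_0) auto
  then have "(\<lambda>x. 2 powr p * x powr (- p)) integrable_on {0..pi / 2}"
    by (rule integrable_on_mult_right)
  then have "(\<lambda>x. 2 powr p * x powr (- p)) absolutely_integrable_on {0..pi / 2}"
    by (rule nonnegative_absolutely_integrable_1) auto
  moreover have "indicator {0..pi / 2} x *\<^sub>R (2 powr p * x powr (- p)) = K x" for x
    by (auto simp: K_def indicator_def powr_divide powr_minus_divide)
  ultimately have "integrable lebesgue K"
    unfolding set_integrable_def by simp
  then have K: "integrable lborel K"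
    by (simp add: integrable_completion)
  \<comment> \<open>A reflected copy of \<open>K\<close> covers the part of \<open>{0..pi}\<close>
    to the left of pi / 2, a translated copy the part to the right.\<close>
  have "integrable lborel (\<lambda>\<phi>. K (pi / 2 + (- 1) * \<phi>) + K (- pi / 2 + 1 * \<phi>))"
    by (intro Bochner_Integration.integrable_add lborel_integrable_real_affine K) auto
  then show ?thesis
    unfolding set_integrable_def
  proof (rule Bochner_Integration.integrable_bound)
    show "AE \<phi> in lborel. norm (indicator {0..pi} \<phi> *\<^sub>R \<bar>cos \<phi>\<bar> powr (- p))
        \<le> norm (K (pi / 2 + (- 1) * \<phi>) + K (- pi / 2 + 1 * \<phi>))"
    proof (rule AE_I2)
      fix \<phi>
      have nonneg: "K x \<ge> 0" for x by (simp add: K_def)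
      have le: "\<bar>cos \<phi>\<bar> powr (- p) \<le> K x"
        if "0 \<le> x" "x \<le> pi / 2" "\<bar>cos \<phi>\<bar> = sin x" for x
      \<comment> \<open>At \<open>x = 0\<close>, that is at the singularity, the left side is
        \<open>0 powr (- p) = 0\<close>.\<close>
      proof (cases "x = 0")
        case False
        then show ?thesis
          using that sin_ge_half[of x] assms by (auto simp: K_def intro!: powr_mono2')
      qed (use that nonneg in auto)
      show "norm (indicator {0..pi} \<phi> *\<^sub>R \<bar>cos \<phi>\<bar> powr (- p))
        \<le> norm (K (pi / 2 + (- 1) * \<phi>) + K (- pi / 2 + 1 * \<phi>))"
      proof (cases "\<phi> \<in> {0..pi}")
        case True
        have "\<bar>cos \<phi>\<bar> powr (- p) \<le> K (pi / 2 + (- 1) * \<phi>) + K (- pi / 2 + 1 * \<phi>)"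
        proof (cases "\<phi> \<le> pi / 2")
          case True
          then show ?thesis
            using \<open>\<phi> \<in> {0..pi}\<close> le[of "pi / 2 + (- 1) * \<phi>"] nonneg[of "- pi / 2 + 1 * \<phi>"]
            by (simp add: sin_diff cos_ge_zero)
        next
          case False
          then have "\<bar>cos \<phi>\<bar> = sin (- pi / 2 + 1 * \<phi>)"
            using \<open>\<phi> \<in> {0..pi}\<close> cos_monotone_0_pi[of "pi / 2" \<phi>] by (simp add: sin_diff)
          then show ?thesis
            using False \<open>\<phi> \<in> {0..pi}\<close> le[of "- pi / 2 + 1 * \<phi>"] nonneg[of "pi / 2 + (- 1) * \<phi>"]
            by simp
        qed
        then show ?thesis using True by simp
      qed simp
    qed
  qed measurable
qed

text \<open>Dominated convergence with a multiple of the modulus of cos \<phi> to the power - p as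
  majorant. The weight w stands for a Bessel function in the H formula and for an exponential in the
  E formula. The constant of the third part does not depend on w, so it is uniform in \<theta> when
  w depends on \<theta>.\<close>

lemma lerch_F_integral:
  assumes "s > 0" "\<beta> > -1"
  shows lerch_F_integrable:
      "continuous_on UNIV w \<Longrightarrow> (\<And>\<phi>. norm (w \<phi>) \<le> 1) \<Longrightarrow>
       set_integrable lborel {0..pi} (\<lambda>\<phi>. w \<phi> * lerch_F s \<beta> \<mu> \<phi>)"
    and lerch_F_integral_sums:
      "continuous_on UNIV w \<Longrightarrow> (\<And>\<phi>. norm (w \<phi>) \<le> 1) \<Longrightarrow>
       (\<lambda>l. integral {0..pi} (\<lambda>\<phi>. w \<phi> * of_real (lerch_cos_term s \<beta> \<mu> l \<phi>))) sums
       (LINT \<phi>:{0..pi}|lborel. w \<phi> * lerch_F s \<beta> \<mu> \<phi>)"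
    and lerch_F_partial_integrals_bounded:
      "\<exists>C. \<forall>w N. continuous_on UNIV w \<longrightarrow> (\<forall>\<phi>. norm (w \<phi>) \<le> 1) \<longrightarrow>
       norm (\<Sum>l<N. integral {0..pi} (\<lambda>\<phi>. w \<phi> * complex_of_real (lerch_cos_term s \<beta> \<mu> l \<phi>))) \<le> C"
proof -
  obtain A p where A: "A \<ge> 0" and p: "0 < p" "p < 1"
    and bound: "\<And>\<mu> N \<phi>. cos \<phi> \<noteq> 0 \<Longrightarrow>
       \<bar>\<Sum>l<N. lerch_cos_term s \<beta> \<mu> l \<phi>\<bar> \<le> A * \<bar>cos \<phi>\<bar> powr (- p)"
    using lerch_cos_partial_sum_bound[OF assms] by blast
  define G where "G \<phi> = indicator {0..pi} \<phi> *\<^sub>R (A * \<bar>cos \<phi>\<bar> powr (- p))" for \<phi> :: real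
  have G: "integrable lborel G"
    using set_integrable_mult_right[of A lborel "{0..pi}", OF integrable_abs_cos_powr[OF p]]
    unfolding G_def set_integrable_def .
  have cos_nz: "cos \<phi> \<noteq> 0" if "\<phi> \<in> {0..pi}" "\<phi> \<noteq> pi / 2" for \<phi>
    using that cos_monotone_0_pi[of \<phi> "pi / 2"] cos_monotone_0_pi[of "pi / 2" \<phi>]
    by (cases "\<phi> < pi / 2") auto
  have cont: "continuous_on B (lerch_cos_term s \<beta> \<mu> l)" for B l
    unfolding lerch_cos_term_def by (intro continuous_intros) (use assms in auto)
  {
    fix w :: "real \<Rightarrow> complex"
    assume w: "continuous_on UNIV w" and w1: "\<And>\<phi>. norm (w \<phi>) \<le> 1"
    define f where "f N \<phi> = indicator {0..pi} \<phi> *\<^sub>R (w \<phi> * of_real (\<Sum>l<N. lerch_cos_term s \<beta> \<mu> l \<phi>))" for N \<phi>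
    define g where "g \<phi> = indicator {0..pi} \<phi> *\<^sub>R (w \<phi> * lerch_F s \<beta> \<mu> \<phi>)" for \<phi>
    have [measurable]: "w \<in> borel_measurable borel"
      using w by (rule borel_measurable_continuous_onI)
    have [measurable]: "lerch_cos_term s \<beta> \<mu> l \<in> borel_measurable borel" for l
      using cont by (rule borel_measurable_continuous_onI)
    have f [measurable]: "f N \<in> borel_measurable borel" for N
      unfolding f_def by measurable
    have lim: "(\<lambda>N. f N \<phi>) \<longlonglongrightarrow> g \<phi>" if "\<phi> \<noteq> pi / 2" for \<phi>
    proof (cases "\<phi> \<in> {0..pi}")
      case True
      then have "(\<lambda>N. \<Sum>l<N. complex_of_real (lerch_cos_term s \<beta> \<mu> l \<phi>)) \<longlonglongrightarrow> lerch_F s \<beta> \<mu> \<phi>"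
        using lerch_F_sums[OF assms cos_nz[OF True that]] unfolding sums_def by blast
      then show ?thesis
        unfolding f_def g_def of_real_sum by (intro tendsto_intros)
    qed (simp add: f_def g_def)
    \<comment> \<open>Convergence to g is known only away from pi / 2. Replacing the approximants at
      this single point by the value of g makes g a limit everywhere.\<close>
    have g [measurable]: "g \<in> borel_measurable borel"
    proof (rule borel_measurable_LIMSEQ_metric)
      show "(\<lambda>\<phi>. if \<phi> = pi / 2 then g (pi / 2) else f N \<phi>) \<in> borel_measurable borel" for N
        by measurable
      show "(\<lambda>N. if \<phi> = pi / 2 then g (pi / 2) else f N \<phi>) \<longlonglongrightarrow> g \<phi>" for \<phi>
      proof (cases "\<phi> = pi / 2")
        case True
        show ?thesis unfolding True by simp
      qed (use lim in simp)
    qed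
    have ne: "AE \<phi> in lborel. \<phi> \<noteq> pi / 2" by (rule AE_lborel_singleton)
    have AElim: "AE \<phi> in lborel. (\<lambda>N. f N \<phi>) \<longlonglongrightarrow> g \<phi>"
      using ne by eventually_elim (rule lim)
    have AEbound: "AE \<phi> in lborel. norm (f N \<phi>) \<le> G \<phi>" for N
      using ne
    proof eventually_elim
      case (elim \<phi>)
      show ?case
      proof (cases "\<phi> \<in> {0..pi}")
        case True
        have "norm (w \<phi>) * \<bar>\<Sum>l<N. lerch_cos_term s \<beta> \<mu> l \<phi>\<bar> \<le> 1 * (A * \<bar>cos \<phi>\<bar> powr (- p))"
          using w1 bound[OF cos_nz[OF True elim]] by (intro mult_mono) auto
        then show ?thesis using True by (simp add: f_def G_def norm_mult flip: of_real_sum)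
      qed (simp add: f_def G_def)
    qed
    have meas: "g \<in> borel_measurable lborel" "f N \<in> borel_measurable lborel" for N by simp_all
    note dct = integrable_dominated_convergence[OF meas G AElim AEbound]
      integrable_dominated_convergence2[OF meas G AElim AEbound]
      integral_dominated_convergence[OF meas G AElim AEbound]
    have int: "integral\<^sup>L lborel (f N) =
        (\<Sum>l<N. integral {0..pi} (\<lambda>\<phi>. w \<phi> * of_real (lerch_cos_term s \<beta> \<mu> l \<phi>)))" for N
    proof -
      have c: "continuous_on {0..pi} (\<lambda>\<phi>. w \<phi> * complex_of_real (lerch_cos_term s \<beta> \<mu> l \<phi>))" for l
        by (intro continuous_intros continuous_on_subset[OF w] cont) auto
      have "continuous_on {0..pi} (\<lambda>\<phi>. w \<phi> * of_real (\<Sum>l<N. lerch_cos_term s \<beta> \<mu> l \<phi>))"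
        by (intro continuous_intros continuous_on_subset[OF w] cont) auto
      then have "set_integrable lborel {0..pi} (\<lambda>\<phi>. w \<phi> * of_real (\<Sum>l<N. lerch_cos_term s \<beta> \<mu> l \<phi>))"
        by (rule borel_integrable_atLeastAtMost')
      from set_borel_integral_eq_integral(2)[OF this]
      have "integral\<^sup>L lborel (f N) = integral {0..pi} (\<lambda>\<phi>. w \<phi> * of_real (\<Sum>l<N. lerch_cos_term s \<beta> \<mu> l \<phi>))"
        unfolding f_def set_lebesgue_integral_def .
      also have "\<dots> = (\<Sum>l<N. integral {0..pi} (\<lambda>\<phi>. w \<phi> * of_real (lerch_cos_term s \<beta> \<mu> l \<phi>)))"
        unfolding of_real_sum sum_distrib_left
        by (intro Henstock_Kurzweil_Integration.integral_sum integrable_continuous_interval c) auto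
      finally show ?thesis .
    qed
    have "set_integrable lborel {0..pi} (\<lambda>\<phi>. w \<phi> * lerch_F s \<beta> \<mu> \<phi>)"
      using dct(1) unfolding set_integrable_def g_def .
    moreover have "(\<lambda>l. integral {0..pi} (\<lambda>\<phi>. w \<phi> * of_real (lerch_cos_term s \<beta> \<mu> l \<phi>))) sums
       (LINT \<phi>:{0..pi}|lborel. w \<phi> * lerch_F s \<beta> \<mu> \<phi>)"
      using dct(3) unfolding sums_def set_lebesgue_integral_def int[symmetric] g_def[symmetric] .
    moreover have "norm (\<Sum>l<N. integral {0..pi} (\<lambda>\<phi>. w \<phi> * of_real (lerch_cos_term s \<beta> \<mu> l \<phi>))) \<le> integral\<^sup>L lborel G" for N
      unfolding int[symmetric]
      using dct(2) G AEbound by (intro order_trans[OF integral_norm_bound] integral_mono_AE) auto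
    ultimately have "set_integrable lborel {0..pi} (\<lambda>\<phi>. w \<phi> * lerch_F s \<beta> \<mu> \<phi>)"
      "(\<lambda>l. integral {0..pi} (\<lambda>\<phi>. w \<phi> * of_real (lerch_cos_term s \<beta> \<mu> l \<phi>))) sums
       (LINT \<phi>:{0..pi}|lborel. w \<phi> * lerch_F s \<beta> \<mu> \<phi>)"
      "norm (\<Sum>l<N. integral {0..pi} (\<lambda>\<phi>. w \<phi> * of_real (lerch_cos_term s \<beta> \<mu> l \<phi>))) \<le> integral\<^sup>L lborel G" for N
      by blast+
  }
  note main = this
  show "continuous_on UNIV w \<Longrightarrow> (\<And>\<phi>. norm (w \<phi>) \<le> 1) \<Longrightarrow>
       set_integrable lborel {0..pi} (\<lambda>\<phi>. w \<phi> * lerch_F s \<beta> \<mu> \<phi>)"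
    by (rule main)
  show "continuous_on UNIV w \<Longrightarrow> (\<And>\<phi>. norm (w \<phi>) \<le> 1) \<Longrightarrow>
       (\<lambda>l. integral {0..pi} (\<lambda>\<phi>. w \<phi> * of_real (lerch_cos_term s \<beta> \<mu> l \<phi>))) sums
       (LINT \<phi>:{0..pi}|lborel. w \<phi> * lerch_F s \<beta> \<mu> \<phi>)"
    by (rule main)
  show "\<exists>C. \<forall>w N. continuous_on UNIV w \<longrightarrow> (\<forall>\<phi>. norm (w \<phi>) \<le> 1) \<longrightarrow>
       norm (\<Sum>l<N. integral {0..pi} (\<lambda>\<phi>. w \<phi> * complex_of_real (lerch_cos_term s \<beta> \<mu> l \<phi>))) \<le> C"
  proof (intro exI allI impI)
    fix w :: "real \<Rightarrow> complex" and N
    assume "continuous_on UNIV w" "\<forall>\<phi>. norm (w \<phi>) \<le> 1"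
    then show "norm (\<Sum>l<N. integral {0..pi} (\<lambda>\<phi>. w \<phi> * complex_of_real (lerch_cos_term s \<beta> \<mu> l \<phi>)))
        \<le> integral\<^sup>L lborel G"
      by (intro main(3)) auto
  qed
qed

subsection \<open>The integral representations\<close>

text \<open>The index n stands for l = n + 1. The parameters m and m' are integers because the
  recursion takes m below zero.\<close>

definition bessel_product_term :: "real \<Rightarrow> real \<Rightarrow> int \<Rightarrow> int \<Rightarrow> real \<Rightarrow> nat \<Rightarrow> real" where
  "bessel_product_term \<alpha> \<beta> m m' r n =
     bessel_J (int (Suc n) + m') r * bessel_J (int (Suc n) + m) r * (real (Suc n) + \<beta>) powr \<alpha>"

text \<open>One factor of the power is split as l + \<beta> = (l + m) + (\<beta> - m), and the
  three-term recurrence is applied to (l + m) times the Bessel function of order l + m. Positivity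
  of l + \<beta> allows the factor to be taken out.\<close>

lemma bessel_product_term_step:
  assumes "\<beta> > -1"
  shows "bessel_product_term \<alpha> \<beta> m m' r n =
    r / 2 * (bessel_product_term (\<alpha> - 1) \<beta> (m - 1) m' r n + bessel_product_term (\<alpha> - 1) \<beta> (m + 1) m' r n)
    + (\<beta> - of_int m) * bessel_product_term (\<alpha> - 1) \<beta> m m' r n"
proof -
  define L where "L = int (Suc n)"
  define y where "y = real (Suc n) + \<beta>"
  have "y > 0" using assms by (simp add: y_def)
  then have pow: "y powr \<alpha> = y * y powr (\<alpha> - 1)"
    by (simp add: powr_diff)
  have "y * bessel_J (L + m) r = of_int (L + m) * bessel_J (L + m) r + (\<beta> - of_int m) * bessel_J (L + m) r"
    by (simp add: y_def L_def algebra_simps)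
  also have "of_int (L + m) * bessel_J (L + m) r =
      r / 2 * (bessel_J (L + (m - 1)) r + bessel_J (L + (m + 1)) r)"
    using bessel_J_recurrence[of "L + m" r] by (simp only: add_diff_eq add.assoc)
  finally have "bessel_J (L + m') r * (y * bessel_J (L + m) r) * y powr (\<alpha> - 1) =
      bessel_J (L + m') r * (r / 2 * (bessel_J (L + (m - 1)) r + bessel_J (L + (m + 1)) r)
        + (\<beta> - of_int m) * bessel_J (L + m) r) * y powr (\<alpha> - 1)"
    by (simp only:)
  then show ?thesis
    unfolding bessel_product_term_def L_def[symmetric] y_def[symmetric] pow
    by (simp only: algebra_simps)
qed

section \<open>The single integral with kernel H\<close>

text \<open>The orders L + m and - (L + m') have the sum m - m', which is free of L and supplies the
  weight, and the difference m + m' + 2 L, which is the frequency of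
  \<open>lerch_cos_term\<close>.\<close>

lemma kernel_H_negative_integral:
  assumes "\<alpha> < 0" "\<beta> > -1"
  shows "set_integrable lborel {0..pi} (kernel_H \<alpha> \<beta> m m' r)"
    and "(\<lambda>n. of_real (pi * bessel_product_term \<alpha> \<beta> m m' r n)) sums
      (LINT \<phi>:{0..pi}|lborel. kernel_H \<alpha> \<beta> m m' r \<phi>)"
proof -
  define w where "w \<phi> = (-1) powi m' * complex_of_real (bessel_J (m - m') (2 * r * cos \<phi>))" for \<phi>
  have H: "kernel_H \<alpha> \<beta> m m' r = (\<lambda>\<phi>. w \<phi> * lerch_F (- \<alpha>) \<beta> (m + m') \<phi>)"
    using \<open>\<alpha> < 0\<close> by (simp add: kernel_H.simps[of \<alpha>] w_def fun_eq_iff)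
  have w: "continuous_on UNIV w" unfolding w_def by (intro continuous_intros)
  have w1: "norm (w \<phi>) \<le> 1" for \<phi>
    by (simp add: w_def norm_mult norm_power_int abs_bessel_J_le_1)
  have "integral {0..pi} (\<lambda>\<phi>. w \<phi> * of_real (lerch_cos_term (- \<alpha>) \<beta> (m + m') n \<phi>)) =
      of_real (pi * bessel_product_term \<alpha> \<beta> m m' r n)" for n
  proof -
    define L where "L = int (Suc n)"
    define c where "c = (-1) powi m' * (-1) ^ Suc n * (real (Suc n) + \<beta>) powr \<alpha>"
    have "((\<lambda>\<phi>. c * (bessel_J ((L + m) + - (L + m')) (2 * r * cos \<phi>) * cos (of_int ((L + m) - - (L + m')) * \<phi>)))
        has_integral c * (pi * bessel_J (L + m) r * bessel_J (- (L + m')) r)) {0..pi}"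
      by (intro has_integral_mult_right bessel_J_product)
    moreover have "(L + m) + - (L + m') = m - m'" "(L + m) - - (L + m') = m + m' + 2 * L" by simp_all
    moreover have "c * (pi * bessel_J (L + m) r * bessel_J (- (L + m')) r) = pi * bessel_product_term \<alpha> \<beta> m m' r n"
    proof -
      \<comment> \<open>The reflection of the order - (L + m') produces a sign that cancels those of
        the kernel and of the alternating series.\<close>
      have "(-1) powi m' * (-1) ^ Suc n * (-1) powi (L + m') = (1 :: real)"
        by (simp add: L_def power_int_add power_int_minus_left)
      moreover have "(-1) powi m' * (-1) ^ Suc n * y * (pi * J * ((-1) powi (L + m') * J')) =
          (-1) powi m' * (-1) ^ Suc n * (-1) powi (L + m') * (pi * (J' * J * y))" for y J J' :: real
        by (simp only: mult_ac)
      ultimately have "(-1) powi m' * (-1) ^ Suc n * y * (pi * J * ((-1) powi (L + m') * J')) = pi * (J' * J * y)"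
        for y J J' :: real
        by (simp only: mult_1)
      then show ?thesis
        unfolding bessel_J_minus c_def bessel_product_term_def L_def[symmetric] .
    qed
    ultimately have "((\<lambda>\<phi>. c * (bessel_J (m - m') (2 * r * cos \<phi>) * cos (of_int (m + m' + 2 * L) * \<phi>)))
        has_integral pi * bessel_product_term \<alpha> \<beta> m m' r n) {0..pi}"
      by (simp only:)
    then have "((\<lambda>\<phi>. complex_of_real (c * (bessel_J (m - m') (2 * r * cos \<phi>) * cos (of_int (m + m' + 2 * L) * \<phi>))))
        has_integral of_real (pi * bessel_product_term \<alpha> \<beta> m m' r n)) {0..pi}"
      by (rule has_integral_of_real)
    moreover have "complex_of_real (c * (bessel_J (m - m') (2 * r * cos \<phi>) * cos (of_int (m + m' + 2 * L) * \<phi>))) =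
        w \<phi> * of_real (lerch_cos_term (- \<alpha>) \<beta> (m + m') n \<phi>)" for \<phi>
      unfolding w_def lerch_cos_term_def c_def L_def by (simp add: powr_minus_divide)
    ultimately show ?thesis by (simp only: integral_unique)
  qed
  note terms = this
  have "- \<alpha> > 0" using \<open>\<alpha> < 0\<close> by simp
  note F = lerch_F_integrable[OF this \<open>\<beta> > -1\<close>] lerch_F_integral_sums[OF this \<open>\<beta> > -1\<close>]
  show "set_integrable lborel {0..pi} (kernel_H \<alpha> \<beta> m m' r)"
    unfolding H by (rule F(1)[OF w w1])
  show "(\<lambda>n. of_real (pi * bessel_product_term \<alpha> \<beta> m m' r n)) sums
      (LINT \<phi>:{0..pi}|lborel. kernel_H \<alpha> \<beta> m m' r \<phi>)"
    using F(2)[OF w w1, where \<mu> = "m + m'"] unfolding H terms .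
qed

lemma set_integral_linear_combination:
  fixes f g h :: "'a \<Rightarrow> complex"
  assumes "set_integrable M A f" "set_integrable M A g" "set_integrable M A h"
  shows "set_integrable M A (\<lambda>x. a * (f x + g x) + b * h x)"
    and "(LINT x:A|M. a * (f x + g x) + b * h x) =
      a * ((LINT x:A|M. f x) + (LINT x:A|M. g x)) + b * (LINT x:A|M. h x)"
  using assms by (simp_all add: set_integral_add)

text \<open>The recursion lowers the real \<alpha> by 1, so the induction runs over a natural number
  above \<alpha>, with m arbitrary since m - 1 and m + 1 occur. Integrability is carried along
  because linearity of the integral requires it.\<close>

lemma kernel_H_integral:
  assumes "\<beta> > -1"
  shows "set_integrable lborel {0..pi} (kernel_H \<alpha> \<beta> m m' r) \<and>
    (\<lambda>n. of_real (pi * bessel_product_term \<alpha> \<beta> m m' r n)) sums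
      (LINT \<phi>:{0..pi}|lborel. kernel_H \<alpha> \<beta> m m' r \<phi>)"
proof -
  have "set_integrable lborel {0..pi} (kernel_H \<alpha> \<beta> m m' r) \<and>
    (\<lambda>n. of_real (pi * bessel_product_term \<alpha> \<beta> m m' r n)) sums
      (LINT \<phi>:{0..pi}|lborel. kernel_H \<alpha> \<beta> m m' r \<phi>)" if "\<alpha> < real N" for N
    using that
  proof (induction N arbitrary: \<alpha> m)
    case 0
    then show ?case using kernel_H_negative_integral[of \<alpha> \<beta>] assms by simp
  next
    case (Suc N)
    show ?case
    proof (cases "\<alpha> < 0")
      case True
      then show ?thesis using kernel_H_negative_integral[of \<alpha> \<beta>] assms by simp
    next
      case False
      have H: "kernel_H \<alpha> \<beta> m m' r = (\<lambda>\<phi>. of_real (r / 2) *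
          (kernel_H (\<alpha> - 1) \<beta> (m - 1) m' r \<phi> + kernel_H (\<alpha> - 1) \<beta> (m + 1) m' r \<phi>)
          + of_real (\<beta> - of_int m) * kernel_H (\<alpha> - 1) \<beta> m m' r \<phi>)"
      proof
        show "kernel_H \<alpha> \<beta> m m' r \<phi> = of_real (r / 2) *
            (kernel_H (\<alpha> - 1) \<beta> (m - 1) m' r \<phi> + kernel_H (\<alpha> - 1) \<beta> (m + 1) m' r \<phi>)
            + of_real (\<beta> - of_int m) * kernel_H (\<alpha> - 1) \<beta> m m' r \<phi>" for \<phi>
          using False by (subst kernel_H.simps[of \<alpha>]) (simp only: if_False)
      qed
      have IH: "set_integrable lborel {0..pi} (kernel_H (\<alpha> - 1) \<beta> k m' r)"
        "(\<lambda>n. of_real (pi * bessel_product_term (\<alpha> - 1) \<beta> k m' r n)) sums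
          (LINT \<phi>:{0..pi}|lborel. kernel_H (\<alpha> - 1) \<beta> k m' r \<phi>)" for k
        using Suc.IH[of "\<alpha> - 1" k] Suc.prems by auto
      have "complex_of_real (pi * bessel_product_term \<alpha> \<beta> m m' r n) =
          of_real (r / 2) * (of_real (pi * bessel_product_term (\<alpha> - 1) \<beta> (m - 1) m' r n)
            + of_real (pi * bessel_product_term (\<alpha> - 1) \<beta> (m + 1) m' r n))
          + of_real (\<beta> - of_int m) * of_real (pi * bessel_product_term (\<alpha> - 1) \<beta> m m' r n)" for n
        unfolding of_real_mult[symmetric] of_real_add[symmetric]
        by (subst bessel_product_term_step[OF assms]) (simp only: distrib_left mult_ac)
      then show ?thesis
        unfolding H set_integral_linear_combination(2)[OF IH(1) IH(1) IH(1)]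
        using set_integral_linear_combination(1)[OF IH(1) IH(1) IH(1)]
        by (simp only: simp_thms) (intro sums_add sums_mult IH(2))
    qed
  qed
  moreover obtain N where "\<alpha> < real N" using reals_Archimedean2 by blast
  ultimately show ?thesis by blast
qed

section \<open>The iterated integral with kernel E\<close>

definition kernel_E_inner :: "real \<Rightarrow> real \<Rightarrow> int \<Rightarrow> int \<Rightarrow> real \<Rightarrow> real \<Rightarrow> complex" where
  "kernel_E_inner \<alpha> \<beta> m m' r \<theta> =
     (LINT \<phi>:{0..pi}|lborel. cis (2 * r * cos \<phi> * cos \<theta>) * kernel_E \<alpha> \<beta> m m' r \<phi> \<theta>)"

text \<open>For fixed \<theta> the \<phi>-integral is taken term by term and yields Bessel functions
  of argument 2 r cos \<theta> by \<open>bessel_J_integral_cos\<close>. The \<theta>-integral of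
  each term is then a Neumann product, and dominated convergence is used a second time.\<close>

lemma kernel_E_negative_integral:
  assumes "\<alpha> < 0" "\<beta> > -1"
  shows "set_integrable lborel {0..pi} (\<lambda>\<phi>. cis (2 * r * cos \<phi> * cos \<theta>) * kernel_E \<alpha> \<beta> m m' r \<phi> \<theta>)"
    and "set_integrable lborel {0..pi / 2} (kernel_E_inner \<alpha> \<beta> m m' r)"
    and "(\<lambda>n. of_real (pi\<^sup>2 / 2 * bessel_product_term \<alpha> \<beta> m m' r n)) sums
      (LINT \<theta>:{0..pi / 2}|lborel. kernel_E_inner \<alpha> \<beta> m m' r \<theta>)"
proof -
  define w where "w \<theta> \<phi> = cis (2 * r * cos \<phi> * cos \<theta>) *
      (\<i> powi (- (m + m')) * complex_of_real (cos (of_int (m - m') * \<theta>)))" for \<theta> \<phi>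
  have E: "(\<lambda>\<phi>. cis (2 * r * cos \<phi> * cos \<theta>) * kernel_E \<alpha> \<beta> m m' r \<phi> \<theta>) =
      (\<lambda>\<phi>. w \<theta> \<phi> * lerch_F (- \<alpha>) \<beta> (m + m') \<phi>)" for \<theta>
    using \<open>\<alpha> < 0\<close> by (simp add: kernel_E.simps[of \<alpha>] w_def fun_eq_iff)
  have w: "continuous_on UNIV (w \<theta>)" for \<theta> unfolding w_def by (intro continuous_intros)
  have w1: "norm (w \<theta> \<phi>) \<le> 1" for \<theta> \<phi>
    by (simp add: w_def norm_mult norm_power_int)
  \<comment> \<open>The value of the n-th inner integral, with sum and difference of the orders
    written out so that \<open>bessel_J_product_quarter\<close> matches.\<close>
  define c where "c n \<theta> = pi * (real (Suc n) + \<beta>) powr \<alpha> *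
      (bessel_J ((int (Suc n) + m') + (int (Suc n) + m)) (2 * r * cos \<theta>) *
        cos (of_int ((int (Suc n) + m') - (int (Suc n) + m)) * \<theta>))" for n \<theta>
  have c: "continuous_on A (c n)" for A n
    unfolding c_def by (intro continuous_intros)
  have terms: "integral {0..pi} (\<lambda>\<phi>. w \<theta> \<phi> * of_real (lerch_cos_term (- \<alpha>) \<beta> (m + m') n \<phi>)) =
      complex_of_real (c n \<theta>)" for \<theta> n
  proof -
    define k where "k = \<i> powi (- (m + m')) * complex_of_real (cos (of_int (m - m') * \<theta>) *
      ((-1) ^ Suc n * (real (Suc n) + \<beta>) powr \<alpha>))"
    have "w \<theta> \<phi> * of_real (lerch_cos_term (- \<alpha>) \<beta> (m + m') n \<phi>) =
        k * (cis (2 * r * cos \<theta> * cos \<phi>) * of_real (cos (of_int (m + m' + 2 * int (Suc n)) * \<phi>)))" for \<phi>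
      unfolding w_def lerch_cos_term_def k_def by (simp add: powr_minus_divide mult_ac)
    then have "integral {0..pi} (\<lambda>\<phi>. w \<theta> \<phi> * of_real (lerch_cos_term (- \<alpha>) \<beta> (m + m') n \<phi>)) =
        k * (of_real pi * \<i> powi (m + m' + 2 * int (Suc n)) *
          of_real (bessel_J (m + m' + 2 * int (Suc n)) (2 * r * cos \<theta>)))"
      by (simp only: integral_mult_right bessel_J_integral_cos)
    also have "\<dots> = of_real (c n \<theta>)"
    proof -
      \<comment> \<open>The prefactor of the kernel reduces the power of i from
        \<open>bessel_J_integral_cos\<close> to (-1)^l, which cancels the alternating sign of the
        cosine series.\<close>
      have "\<i> powi (- (m + m')) * \<i> powi (m + m' + 2 * int (Suc n)) = (-1) ^ Suc n"
      proof -
        have "\<i> powi (- (m + m')) * \<i> powi (m + m' + 2 * int (Suc n)) = \<i> powi int (2 * Suc n)"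
          by (simp add: power_int_add[symmetric] del: of_nat_mult) (simp add: algebra_simps)
        also have "\<dots> = (-1) ^ Suc n"
          unfolding power_int_of_nat power_mult by simp
        finally show ?thesis .
      qed
      moreover have "(-1) ^ Suc n * (-1) ^ Suc n = (1 :: complex)"
        by (simp flip: power_mult_distrib)
      ultimately have sign: "\<i> powi (- (m + m')) * \<i> powi (m + m' + 2 * int (Suc n)) * (-1) ^ Suc n = 1"
        by simp
      have "m + m' + 2 * int (Suc n) = (int (Suc n) + m') + (int (Suc n) + m)" by simp
      moreover have "cos (of_int (m - m') * \<theta>) = cos (of_int ((int (Suc n) + m') - (int (Suc n) + m)) * \<theta>)"
        using cos_minus[of "of_int (m - m') * \<theta>"] by (simp add: algebra_simps)
      ultimately have c: "c n \<theta> = pi * (real (Suc n) + \<beta>) powr \<alpha> *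
          (bessel_J (m + m' + 2 * int (Suc n)) (2 * r * cos \<theta>) * cos (of_int (m - m') * \<theta>))"
        unfolding c_def by (simp only:)
      have "k * (of_real pi * \<i> powi (m + m' + 2 * int (Suc n)) *
          of_real (bessel_J (m + m' + 2 * int (Suc n)) (2 * r * cos \<theta>))) =
          \<i> powi (- (m + m')) * \<i> powi (m + m' + 2 * int (Suc n)) * (-1) ^ Suc n * of_real (c n \<theta>)"
        unfolding c k_def of_real_mult of_real_power of_real_minus of_real_1 by (simp only: mult_ac)
      then show ?thesis unfolding sign by simp
    qed
    finally show ?thesis .
  qed
  have pos: "- \<alpha> > 0" using \<open>\<alpha> < 0\<close> by simp
  note F = lerch_F_integrable[OF pos \<open>\<beta> > -1\<close>] lerch_F_integral_sums[OF pos \<open>\<beta> > -1\<close>]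
  obtain C where C: "\<forall>w N. continuous_on UNIV w \<longrightarrow> (\<forall>\<phi>. norm (w \<phi>) \<le> 1) \<longrightarrow>
      norm (\<Sum>l<N. integral {0..pi} (\<lambda>\<phi>. w \<phi> * complex_of_real (lerch_cos_term (- \<alpha>) \<beta> (m + m') l \<phi>))) \<le> C"
    using lerch_F_partial_integrals_bounded[OF pos \<open>\<beta> > -1\<close>, of "m + m'"] ..
  show "set_integrable lborel {0..pi} (\<lambda>\<phi>. cis (2 * r * cos \<phi> * cos \<theta>) * kernel_E \<alpha> \<beta> m m' r \<phi> \<theta>)"
    unfolding E by (rule F(1)[OF w w1])
  have inner: "(\<lambda>n. complex_of_real (c n \<theta>)) sums kernel_E_inner \<alpha> \<beta> m m' r \<theta>"
    "norm (\<Sum>n<N. complex_of_real (c n \<theta>)) \<le> C" for \<theta> N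
  proof -
    show "(\<lambda>n. complex_of_real (c n \<theta>)) sums kernel_E_inner \<alpha> \<beta> m m' r \<theta>"
      using F(2)[OF w w1, where \<mu> = "m + m'"] unfolding kernel_E_inner_def E terms .
    show "norm (\<Sum>n<N. complex_of_real (c n \<theta>)) \<le> C"
      using C[rule_format, OF w w1] unfolding terms .
  qed
  define f where "f N \<theta> = indicator {0..pi / 2} \<theta> *\<^sub>R (\<Sum>n<N. complex_of_real (c n \<theta>))" for N \<theta>
  define g where "g \<theta> = indicator {0..pi / 2} \<theta> *\<^sub>R kernel_E_inner \<alpha> \<beta> m m' r \<theta>" for \<theta>
  have [measurable]: "c n \<in> borel_measurable borel" for n
    using c by (rule borel_measurable_continuous_onI)
  have f [measurable]: "f N \<in> borel_measurable borel" for N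
    unfolding f_def by measurable
  have lim: "(\<lambda>N. f N \<theta>) \<longlonglongrightarrow> g \<theta>" for \<theta>
    using inner(1)[of \<theta>] unfolding f_def g_def sums_def by (intro tendsto_intros)
  have g: "g \<in> borel_measurable borel"
    using f lim by (rule borel_measurable_LIMSEQ_metric)
  \<comment> \<open>The bound \<open>C\<close> depends neither on \<theta> nor on the number of
    terms, so a constant on the bounded interval is a majorant.\<close>
  have G: "integrable lborel (\<lambda>\<theta>. indicator {0..pi / 2} \<theta> *\<^sub>R C)"
    by simp
  have meas: "g \<in> borel_measurable lborel" "f N \<in> borel_measurable lborel" for N
    using f g by simp_all
  have AElim: "AE \<theta> in lborel. (\<lambda>N. f N \<theta>) \<longlonglongrightarrow> g \<theta>"
    using lim by simp
  have AEbound: "AE \<theta> in lborel. norm (f N \<theta>) \<le> indicator {0..pi / 2} \<theta> *\<^sub>R C" for N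
    using inner(2) by (auto simp: f_def indicator_def simp flip: of_real_sum)
  note dct = integrable_dominated_convergence[OF meas G AElim AEbound]
      integrable_dominated_convergence2[OF meas G AElim AEbound]
      integral_dominated_convergence[OF meas G AElim AEbound]
  have "integral\<^sup>L lborel (f N) = (\<Sum>n<N. of_real (pi\<^sup>2 / 2 * bessel_product_term \<alpha> \<beta> m m' r n))" for N
  proof -
    have "continuous_on {0..pi / 2} (\<lambda>\<theta>. \<Sum>n<N. complex_of_real (c n \<theta>))"
      by (intro continuous_intros c)
    then have "set_integrable lborel {0..pi / 2} (\<lambda>\<theta>. \<Sum>n<N. complex_of_real (c n \<theta>))"
      by (rule borel_integrable_atLeastAtMost')
    from set_borel_integral_eq_integral(2)[OF this]
    have "integral\<^sup>L lborel (f N) = integral {0..pi / 2} (\<lambda>\<theta>. \<Sum>n<N. complex_of_real (c n \<theta>))"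
      unfolding f_def set_lebesgue_integral_def .
    also have "\<dots> = (\<Sum>n<N. of_real (pi * (real (Suc n) + \<beta>) powr \<alpha> *
        (pi / 2 * bessel_J (int (Suc n) + m') r * bessel_J (int (Suc n) + m) r)))"
      unfolding c_def
      by (intro integral_unique has_integral_sum has_integral_of_real has_integral_mult_right
          bessel_J_product_quarter) simp
    finally show ?thesis
      by (simp add: bessel_product_term_def power2_eq_square mult_ac)
  qed
  note int = this
  show "set_integrable lborel {0..pi / 2} (kernel_E_inner \<alpha> \<beta> m m' r)"
    using dct(1) unfolding set_integrable_def g_def .
  show "(\<lambda>n. of_real (pi\<^sup>2 / 2 * bessel_product_term \<alpha> \<beta> m m' r n)) sums
      (LINT \<theta>:{0..pi / 2}|lborel. kernel_E_inner \<alpha> \<beta> m m' r \<theta>)"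
    using dct(3) unfolding int sums_def set_lebesgue_integral_def g_def[symmetric] .
qed

text \<open>The same induction over a natural number above \<alpha>, with linearity used for the
  inner and again for the outer integral.\<close>

lemma kernel_E_integral:
  assumes "\<beta> > -1"
  shows "(\<forall>\<theta>. set_integrable lborel {0..pi}
      (\<lambda>\<phi>. cis (2 * r * cos \<phi> * cos \<theta>) * kernel_E \<alpha> \<beta> m m' r \<phi> \<theta>)) \<and>
    set_integrable lborel {0..pi / 2} (kernel_E_inner \<alpha> \<beta> m m' r) \<and>
    (\<lambda>n. of_real (pi\<^sup>2 / 2 * bessel_product_term \<alpha> \<beta> m m' r n)) sums
      (LINT \<theta>:{0..pi / 2}|lborel. kernel_E_inner \<alpha> \<beta> m m' r \<theta>)"
proof -
  have "(\<forall>\<theta>. set_integrable lborel {0..pi}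
      (\<lambda>\<phi>. cis (2 * r * cos \<phi> * cos \<theta>) * kernel_E \<alpha> \<beta> m m' r \<phi> \<theta>)) \<and>
    set_integrable lborel {0..pi / 2} (kernel_E_inner \<alpha> \<beta> m m' r) \<and>
    (\<lambda>n. of_real (pi\<^sup>2 / 2 * bessel_product_term \<alpha> \<beta> m m' r n)) sums
      (LINT \<theta>:{0..pi / 2}|lborel. kernel_E_inner \<alpha> \<beta> m m' r \<theta>)" if "\<alpha> < real N" for N
    using that
  proof (induction N arbitrary: \<alpha> m)
    case 0
    then show ?case using kernel_E_negative_integral[of \<alpha> \<beta>] assms by simp
  next
    case (Suc N)
    show ?case
    proof (cases "\<alpha> < 0")
      case True
      then show ?thesis using kernel_E_negative_integral[of \<alpha> \<beta>] assms by simp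
    next
      case False
      define e where "e k \<theta> \<phi> = cis (2 * r * cos \<phi> * cos \<theta>) * kernel_E (\<alpha> - 1) \<beta> k m' r \<phi> \<theta>" for k \<theta> \<phi>
      have IH: "set_integrable lborel {0..pi} (e k \<theta>)"
        "set_integrable lborel {0..pi / 2} (kernel_E_inner (\<alpha> - 1) \<beta> k m' r)"
        "(\<lambda>n. of_real (pi\<^sup>2 / 2 * bessel_product_term (\<alpha> - 1) \<beta> k m' r n)) sums
          (LINT \<theta>:{0..pi / 2}|lborel. kernel_E_inner (\<alpha> - 1) \<beta> k m' r \<theta>)" for k \<theta>
        using Suc.IH[of "\<alpha> - 1" k] Suc.prems unfolding e_def by auto
      have E: "(\<lambda>\<phi>. cis (2 * r * cos \<phi> * cos \<theta>) * kernel_E \<alpha> \<beta> m m' r \<phi> \<theta>) =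
          (\<lambda>\<phi>. of_real (r / 2) * (e (m - 1) \<theta> \<phi> + e (m + 1) \<theta> \<phi>) + of_real (\<beta> - of_int m) * e m \<theta> \<phi>)" for \<theta>
        using False unfolding e_def
        by (subst kernel_E.simps) (simp only: if_False distrib_left mult_ac)
      \<comment> \<open>Integrability in \<phi> for every \<theta> lets the recursion of the kernel
        pass through the inner integral.\<close>
      have I: "kernel_E_inner \<alpha> \<beta> m m' r = (\<lambda>\<theta>. of_real (r / 2) *
          (kernel_E_inner (\<alpha> - 1) \<beta> (m - 1) m' r \<theta> + kernel_E_inner (\<alpha> - 1) \<beta> (m + 1) m' r \<theta>)
          + of_real (\<beta> - of_int m) * kernel_E_inner (\<alpha> - 1) \<beta> m m' r \<theta>)"
        unfolding kernel_E_inner_def[abs_def] E set_integral_linear_combination(2)[OF IH(1) IH(1) IH(1)]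
        unfolding e_def ..
      have "complex_of_real (pi\<^sup>2 / 2 * bessel_product_term \<alpha> \<beta> m m' r n) =
          of_real (r / 2) * (of_real (pi\<^sup>2 / 2 * bessel_product_term (\<alpha> - 1) \<beta> (m - 1) m' r n)
            + of_real (pi\<^sup>2 / 2 * bessel_product_term (\<alpha> - 1) \<beta> (m + 1) m' r n))
          + of_real (\<beta> - of_int m) * of_real (pi\<^sup>2 / 2 * bessel_product_term (\<alpha> - 1) \<beta> m m' r n)" for n
        unfolding of_real_mult[symmetric] of_real_add[symmetric]
        by (subst bessel_product_term_step[OF assms]) (simp only: distrib_left mult_ac)
      then show ?thesis
        unfolding E I set_integral_linear_combination(2)[OF IH(2) IH(2) IH(2)]
        using set_integral_linear_combination(1)[OF IH(1) IH(1) IH(1)]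
          set_integral_linear_combination(1)[OF IH(2) IH(2) IH(2)]
        by (simp only: simp_thms) (intro sums_add sums_mult IH(3))
    qed
  qed
  moreover obtain N where "\<alpha> < real N" using reals_Archimedean2 by blast
  ultimately show ?thesis by blast
qed

text \<open>The integrability conjuncts guarantee that the integrals have their usual meaning rather
  than the default value 0, and \<open>sums\<close> includes convergence of the series.\<close>

theorem proposition5p3:
  fixes \<alpha> \<beta> r :: real and m m' :: nat
  assumes "\<alpha> \<ge> 0" and "\<beta> > -1"
  shows
    "   (\<forall>\<theta>\<in>{0..pi/2}. set_integrable lborel {0..pi}
        (\<lambda>\<phi>. exp (\<i> * of_real (2 * r * cos \<phi> * cos \<theta>)) * kernel_E \<alpha> \<beta> (int m) (int m') r \<phi> \<theta>))
      \<and> (set_integrable lborel {0..pi/2}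
        (\<lambda>\<theta>. LINT \<phi>:{0..pi}|lborel.
          exp (\<i> * of_real (2 * r * cos \<phi> * cos \<theta>)) * kernel_E \<alpha> \<beta> (int m) (int m') r \<phi> \<theta>))
      \<and> ((\<lambda>n. let l = Suc n in complex_of_real
        (bessel_J (int (l + m')) r * bessel_J (int (l + m)) r * (real l + \<beta>) powr \<alpha>))
      sums (of_real (2 / pi\<^sup>2) *
        (LINT \<theta>:{0..pi/2}|lborel. LINT \<phi>:{0..pi}|lborel.
          exp (\<i> * of_real (2 * r * cos \<phi> * cos \<theta>)) * kernel_E \<alpha> \<beta> (int m) (int m') r \<phi> \<theta>)))
      \<and> (set_integrable lborel {0..pi} (\<lambda>\<phi>. kernel_H \<alpha> \<beta> (int m) (int m') r \<phi>))
      \<and> ((\<lambda>n. let l = Suc n in complex_of_real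
        (bessel_J (int (l + m')) r * bessel_J (int (l + m)) r * (real l + \<beta>) powr \<alpha>))
      sums (of_real (1 / pi) *
        (LINT \<phi>:{0..pi}|lborel. kernel_H \<alpha> \<beta> (int m) (int m') r \<phi>)))"
proof -
  let ?T = "bessel_product_term \<alpha> \<beta> (int m) (int m') r"
  have T: "(\<lambda>n. let l = Suc n in complex_of_real
        (bessel_J (int (l + m')) r * bessel_J (int (l + m)) r * (real l + \<beta>) powr \<alpha>)) = (\<lambda>n. of_real (?T n))"
    by (simp only: bessel_product_term_def Let_def of_nat_add)
  \<comment> \<open>The normalisation pi^2 / 2 is the product of pi from the inner integral and pi /
    2 from the quarter-period Neumann formula.\<close>
  have E: "(\<lambda>n. of_real (2 / pi\<^sup>2) * complex_of_real (pi\<^sup>2 / 2 * ?T n)) = (\<lambda>n. of_real (?T n))"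
    unfolding of_real_mult[symmetric] by simp
  have H: "(\<lambda>n. of_real (1 / pi) * complex_of_real (pi * ?T n)) = (\<lambda>n. of_real (?T n))"
    unfolding of_real_mult[symmetric] by simp
  note kE = kernel_E_integral[OF assms(2), of r \<alpha> "int m" "int m'"]
    and kH = kernel_H_integral[OF assms(2), of \<alpha> "int m" "int m'" r]
  have "(\<lambda>n. of_real (?T n)) sums (of_real (2 / pi\<^sup>2) *
      (LINT \<theta>:{0..pi / 2}|lborel. kernel_E_inner \<alpha> \<beta> (int m) (int m') r \<theta>))"
    unfolding E[symmetric] using kE by (intro sums_mult) blast
  moreover have "(\<lambda>n. of_real (?T n)) sums (of_real (1 / pi) *
      (LINT \<phi>:{0..pi}|lborel. kernel_H \<alpha> \<beta> (int m) (int m') r \<phi>))"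
    unfolding H[symmetric] using kH by (intro sums_mult) blast
  ultimately show ?thesis
    unfolding T cis_conv_exp[symmetric] kernel_E_inner_def[symmetric] using kE kH by blast
qed

end
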